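(* Consider the multiple change point model of the context (with $J=J(N)$ allowed to grow with $N$), satisfying conditions (M1), (M2), (M3), (M4-Gaussian) and (M6) stated there, and suppose the first stage estimators satisfy the first-stage consistency property stated there with a sequence $\rho_N$ such that $J\rho_N\to0$. Let $Q_{\Delta,\sigma_1,\sigma_2}$ and $P_{\Delta,\sigma_1,\sigma_2}$ be as defined in the context. Then for every $\alpha\in(0,1)$, as $N\to\infty$, $$\mathbb P\Big[\hat J=J;\ |\lambda_2(\tau_j,\hat\tau^{(2)}_j)|\le Q_{|\Delta_j|-2\rho_N,\sigma_{j-1},\sigma_j}(\sqrt[J]{1-\alpha})\ \text{for all }j=1,\dots,J\Big]=\prod_{j=1}^JP_{|\Delta_j|-2\rho_N,\sigma_{j-1},\sigma_j}(\sqrt[J]{1-\alpha})+o(1)$$ and $$\mathbb P\Big[\hat J=J;\ |\lambda_2(\tau_j,\hat\tau^{(2)}_j)|\le Q_{|\Delta_j|+2\rho_N,\sigma_{j-1},\sigma_j}(\sqrt[J]{1-\alpha})\ \text{for all }j=1,\dots,J\Big]=\prod_{j=1}^JP_{|\Delta_j|+2\rho_N,\sigma_{j-1},\sigma_j}(\sqrt[J]{1-\alpha})+o(1).$$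
   Context: Model. For each $N$ one observes $Y_i=\theta_i+\varepsilon_i$, $i=1,\dots,N$ (a triangular array; dependence on $N$ is suppressed). There are change points $1=\tau_0<\tau_1<\dots<\tau_J<\tau_{J+1}=N$, with $J=J(N)\ge1$, and levels $\nu_0,\dots,\nu_J$ with $\theta_i=\nu_j$ for $\tau_j<i\le\tau_{j+1}$ (and $\theta_1=\nu_0$). Write $\Delta_j=\nu_j-\nu_{j-1}$. Conditions: (M1) $\max_i|\theta_i|\le\bar\theta$ for a constant $\bar\theta\in(0,\infty)$ not depending on $N$. (M2) $\min_{1\le j\le J}|\nu_j-\nu_{j-1}|\ge\underline\Delta$ for a constant $\underline\Delta>0$ not depending on $N$. (M3) There are $\Xi\in[0,1)$ and $C>0$ with $\delta_N:=\min_{0\le i\le J}(\tau_{i+1}-\tau_i)\ge CN^{1-\Xi}$ for all large $N$. (M4-Gaussian) $\varepsilon_1,\dots,\varepsilon_N$ are independent zero mean Gaussian random variables with variances bounded below by $\sigma_{\min}^2$ and above by $\sigma_{\max}^2$, where $\sigma_{\min},\sigma_{\max}$ are positive constants not depending on $N$. (M6) For every $0\le j\le J$, the variables $\varepsilon_{\tau_j+1},\dots,\varepsilon_{\tau_{j+1}}$ all have the same distribution as $\mathcal E_j$, where $\mathcal E_0,\mathcal E_1,\dots$ are fixed random variables whose distributions do not change with $N$; thus $\mathcal E_j\sim N(0,\sigma_j^2)$ with $\sigma_{\min}\le\sigma_j\le\sigma_{\max}$. Intelligent sampling. Stage 1: let $N_1=K_1N^\gamma$ with $K_1>0$, $\gamma\in(\Xi,1)$,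 $N/N_1=o(\delta_N)$. From the subsample $\{Y_i: i \text{ a multiple of }\lfloor N/N_1\rfloor\}$ only, some procedure produces estimators $\hat J$ of $J$, $\hat\tau^{(1)}_1,\dots,\hat\tau^{(1)}_{\hat J}$ of the change points, and $\hat\nu^{(1)}_0,\dots,\hat\nu^{(1)}_{\hat J}$ of the levels. First-stage consistency property: $$\mathbb P\Big[\hat J=J,\ \max_{1\le i\le J}|\hat\tau^{(1)}_i-\tau_i|\le w(N),\ \max_{0\le i\le J}|\hat\nu^{(1)}_i-\nu_i|\le\rho_N\Big]\to1$$ for some sequences with $w(N)\to\infty$, $w(N)=o(\delta_N)$, $w(N)\ge cN^{1-\gamma}$ for some constant $c>0$, and $\rho_N\to0$. Stage 2: fix an integer $K>1$; let $S^{(2)}(\hat\tau^{(1)}_i)$ be the set of integers in $[\hat\tau^{(1)}_i-Kw(N),\hat\tau^{(1)}_i+Kw(N)]$ not divisible by $\lfloor N/N_1\rfloor$. For $i=1,\dots,\hat J$, $$\hat\tau^{(2)}_i=\arg\min_{d\in S^{(2)}(\hat\tau^{(1)}_i)}\ \sum_{j\in S^{(2)}(\hat\tau^{(1)}_i)}\big[Y_j-\hat\nu^{(1)}_{i-1}1(j\le d)-\hat\nu^{(1)}_i1(j>d)\big]^2 .$$ Signed counting distance: $\lambda_2(a,b)$ is the number of integers $i\in\{1,\dots,N\}$ with $a<i\le b$ that are not multiples of $\lfloor N/N_1\rfloor$ if $a\le b$, and minus the number of such integers with $b<i\le a$ otherwise. Random walk quantiles: for positive $\Delta,\sigma_1,\sigma_2$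 let $X_{\Delta,\sigma_1,\sigma_2}(0)=0$, $X_{\Delta,\sigma_1,\sigma_2}(t)=t\Delta/2+\sum_{i=1}^t\varepsilon^*_i$ for integers $t>0$, $X_{\Delta,\sigma_1,\sigma_2}(t)=|t|\Delta/2+\sum_{i=0}^{|t|-1}\varepsilon^*_{-i}$ for integers $t<0$, where the $\varepsilon_i^*$ are independent, $\varepsilon^*_i\sim N(0,\sigma_1^2)$ for $i\le0$ and $\varepsilon^*_i\sim N(0,\sigma_2^2)$ for $i>0$. Let $L_{\Delta,\sigma_1,\sigma_2}=\arg\min_{t\in\mathbb Z}X_{\Delta,\sigma_1,\sigma_2}(t)$. For $p\in(0,1)$, $Q_{\Delta,\sigma_1,\sigma_2}(p)$ is the $p$-quantile of $|L_{\Delta,\sigma_1,\sigma_2}|$, i.e. the smallest integer $t\ge0$ with $\mathbb P[|L_{\Delta,\sigma_1,\sigma_2}|\le t]\ge p$, and $P_{\Delta,\sigma_1,\sigma_2}(p)=\mathbb P[|L_{\Delta,\sigma_1,\sigma_2}|\le Q_{\Delta,\sigma_1,\sigma_2}(p)]$. (Since $\rho_N\to0$, $|\Delta_j|-2\rho_N>0$ for all $j$ when $N$ is large.) *)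

theory Defs
  imports "HOL-Probability.Probability" "HOL-Library.Landau_Symbols"
begin

definition skip :: "real \<Rightarrow> real \<Rightarrow> nat \<Rightarrow> nat" where
  "skip K1 \<gamma> N = nat \<lfloor>real N / (K1 * real N powr \<gamma>)\<rfloor>"

definition grid :: "real \<Rightarrow> real \<Rightarrow> nat \<Rightarrow> nat set" where
  "grid K1 \<gamma> N = {i \<in> {1..N}. skip K1 \<gamma> N dvd i}"

definition min_gap :: "(nat \<Rightarrow> nat) \<Rightarrow> nat \<Rightarrow> nat" where
  "min_gap \<tau> J = Min ((\<lambda>i. \<tau> (i + 1) - \<tau> i) ` {0..J})"

text \<open>A statistic \<open>T\<close> produced by a (measurable) procedure that sees only the
  observations \<open>Y i\<close> with index in \<open>G\<close>.\<close>

definition statistic_of ::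
  "'a measure \<Rightarrow> (nat \<Rightarrow> 'a \<Rightarrow> real) \<Rightarrow> nat set \<Rightarrow> 'b measure \<Rightarrow> ('a \<Rightarrow> 'b) \<Rightarrow> bool" where
  "statistic_of M Y G L T \<longleftrightarrow>
     (\<exists>f \<in> measurable (\<Pi>\<^sub>M i\<in>G. borel) L. \<forall>\<omega>\<in>space M. T \<omega> = f (\<lambda>i\<in>G. Y i \<omega>))"

text \<open>The second-stage window is restricted to \<open>{1..N}\<close>, where the data live. Under first-stage
  consistency this removes nothing for large \<open>N\<close>.\<close>

definition window :: "real \<Rightarrow> real \<Rightarrow> nat \<Rightarrow> real \<Rightarrow> real \<Rightarrow> nat set" where
  "window K1 \<gamma> N r x = {d \<in> {1..N}. real d \<in> {x - r .. x + r} \<and> \<not> skip K1 \<gamma> N dvd d}"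

definition split_argmin :: "nat set \<Rightarrow> (nat \<Rightarrow> real) \<Rightarrow> real \<Rightarrow> real \<Rightarrow> nat" where
  "split_argmin S y a b =
     arg_min_on (\<lambda>d. \<Sum>j\<in>S. (y j - a * of_bool (j \<le> d) - b * of_bool (j > d))\<^sup>2) S"

definition lambda2 :: "real \<Rightarrow> real \<Rightarrow> nat \<Rightarrow> nat \<Rightarrow> nat \<Rightarrow> int" where
  "lambda2 K1 \<gamma> N a b =
     (if a \<le> b then int (card {i \<in> {1..N}. a < i \<and> i \<le> b \<and> \<not> skip K1 \<gamma> N dvd i})
      else - int (card {i \<in> {1..N}. b < i \<and> i \<le> a \<and> \<not> skip K1 \<gamma> N dvd i}))"

definition walk_noise :: "real \<Rightarrow> real \<Rightarrow> (int \<Rightarrow> real) measure" where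
  "walk_noise \<sigma>1 \<sigma>2 =
     (\<Pi>\<^sub>M i\<in>UNIV. density lborel (normal_density 0 (if i \<le> 0 then \<sigma>1 else \<sigma>2)))"

definition walk :: "real \<Rightarrow> (int \<Rightarrow> real) \<Rightarrow> int \<Rightarrow> real" where
  "walk \<Delta> e t =
     (if t > 0 then real_of_int t * \<Delta> / 2 + (\<Sum>i\<in>{1..t}. e i)
      else if t < 0 then real_of_int \<bar>t\<bar> * \<Delta> / 2 + (\<Sum>i\<in>{0..\<bar>t\<bar> - 1}. e (- i))
      else 0)"

text \<open>For positive parameters the minimiser over the integers exists and is unique almost surely.
  Choosing a minimiser of least modulus makes \<open>\<bar>walk_argmin \<Delta> e\<bar>\<close> measurable in \<open>e\<close>; an
  unrestricted Hilbert choice among the minimisers need not be measurable.\<close>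

definition walk_argmin :: "real \<Rightarrow> (int \<Rightarrow> real) \<Rightarrow> int" where
  "walk_argmin \<Delta> e = arg_min abs (is_arg_min (walk \<Delta> e) (\<lambda>_. True))"

definition walk_cdf :: "real \<Rightarrow> real \<Rightarrow> real \<Rightarrow> nat \<Rightarrow> real" where
  "walk_cdf \<Delta> \<sigma>1 \<sigma>2 t =
     measure (walk_noise \<sigma>1 \<sigma>2) {e \<in> space (walk_noise \<sigma>1 \<sigma>2). \<bar>walk_argmin \<Delta> e\<bar> \<le> int t}"

definition walk_Q :: "real \<Rightarrow> real \<Rightarrow> real \<Rightarrow> real \<Rightarrow> nat" where
  "walk_Q \<Delta> \<sigma>1 \<sigma>2 p = (LEAST t. walk_cdf \<Delta> \<sigma>1 \<sigma>2 t \<ge> p)"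

definition walk_P :: "real \<Rightarrow> real \<Rightarrow> real \<Rightarrow> real \<Rightarrow> real" where
  "walk_P \<Delta> \<sigma>1 \<sigma>2 p = walk_cdf \<Delta> \<sigma>1 \<sigma>2 (walk_Q \<Delta> \<sigma>1 \<sigma>2 p)"

end

theory Submission
  imports Defs "HOL-Real_Asymp.Real_Asymp"
begin

text \<open>
  On the first-stage event the second-stage criterion around the \<open>j\<close>-th change point is, up to a
  positive factor and an additive constant, a two-sided random walk driven by the off-grid noise,
  whose drifts on the two sides differ from \<open>\<bar>\<Delta>\<^sub>j\<bar> / 2\<close> by at most \<open>\<rho>\<^sub>N\<close>. So no conditioning on the first
  stage is necessary: it suffices that the walk with the deterministic drift
  \<open>(\<bar>\<Delta>\<^sub>j\<bar> \<plusminus> 2 \<rho>\<^sub>N) / 2\<close> has a minimiser \<open>L\<close> near the origin that beats every other site \<open>k\<close> by more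
  than \<open>2 \<rho>\<^sub>N (\<bar>k\<bar> + \<bar>L\<bar>)\<close>, since then \<open>L\<close> also minimises the perturbed walk on any window that is
  large enough. A union bound over pairs of sites, with an exponential tilt and one increment
  integrated out, shows that this fails with probability
  \<open>O (\<rho>\<^sub>N + exp (- c w\<^sub>N))\<close>, uniformly in \<open>j\<close>. The walks at different change points use disjoint
  blocks of noise and are independent, and \<open>J \<rho>\<^sub>N + J exp (- c w\<^sub>N) \<longlonglongrightarrow> 0\<close> because
  \<open>J \<le> N\<close> and \<open>w\<^sub>N\<close> grows like a power of \<open>N\<close>. The quantile levels play no role.
\<close>

subsection \<open>Gaussian products: Chernoff and small ball bounds\<close>

text \<open>Since \<open>J\<close> may grow with \<open>N\<close>, an o(1) error at each change
  point is not enough: the errors add up, so each must be small compared with \<open>1 / J\<close>.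
  This is why ties are bounded by an interval length times a bounded density, which is linear in the
  margin. The sum over pairs of sites converges because a minimiser has walk value at most
  \<open>walk \<Delta> e 0 = 0\<close>. In a near tie the farther site is then low as well, up to a
  slack that the tilt absorbs; at distance \<open>n\<close> the positive drift makes this
  exponentially unlikely, which pays for the order \<open>n^2\<close> pairs and for a tie interval
  of length proportional to \<open>n\<close>. The window and the fitted levels are random. The
  window is sandwiched between two deterministic radii, measured in ranks among the off-grid
  indices. The fitted levels enter only through the drift: they move the midpoint by at most \<rho>,
  and the deterministic shift of the drift contributes another \<rho>, hence a margin of
  \<open>2 * \<rho>\<close> per step. What remains is an event in the noise alone.\<close>

lemma exp_tilt_normal_density:
  assumes "\<sigma> > 0"
  shows "exp (- l * x) * normal_density 0 \<sigma> x
    = exp (l\<^sup>2 * \<sigma>\<^sup>2 / 2) * normal_density (- l * \<sigma>\<^sup>2) \<sigma> x"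
proof -
  \<comment> \<open>Completing the square: the tilt moves the mean to
    \<open>- l * \<sigma>\<^sup>2\<close> and keeps the variance, so tilted bounds are again bounds
    on Gaussian densities.\<close>
  have "- l * x + - (x - 0)\<^sup>2 / (2 * \<sigma>\<^sup>2)
    = l\<^sup>2 * \<sigma>\<^sup>2 / 2 + - (x - (- l * \<sigma>\<^sup>2))\<^sup>2 / (2 * \<sigma>\<^sup>2)"
    using assms by (simp add: field_simps power2_eq_square)
  then have "exp (- l * x) * exp (- (x - 0)\<^sup>2 / (2 * \<sigma>\<^sup>2))
    = exp (l\<^sup>2 * \<sigma>\<^sup>2 / 2) * exp (- (x - (- l * \<sigma>\<^sup>2))\<^sup>2 / (2 * \<sigma>\<^sup>2))"
    by (simp flip: exp_add)
  then show ?thesis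
    by (simp add: normal_density_def divide_simps)
qed

lemma nn_integral_exp_normal:
  assumes "\<sigma> > 0"
  shows "(\<integral>\<^sup>+x. ennreal (exp (- l * x)) \<partial>density lborel (normal_density 0 \<sigma>))
    = ennreal (exp (l\<^sup>2 * \<sigma>\<^sup>2 / 2))"
proof -
  interpret N: prob_space "density lborel (normal_density (- l * \<sigma>\<^sup>2) \<sigma>)"
    using assms by (rule prob_space_normal_density)
  have "(\<integral>\<^sup>+x. ennreal (exp (- l * x)) \<partial>density lborel (normal_density 0 \<sigma>))
    = (\<integral>\<^sup>+x. ennreal (exp (l\<^sup>2 * \<sigma>\<^sup>2 / 2)) * ennreal (normal_density (- l * \<sigma>\<^sup>2) \<sigma> x) \<partial>lborel)"
    using exp_tilt_normal_density[OF assms, of l]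
    by (subst nn_integral_density)
       (auto intro!: nn_integral_cong simp: ennreal_mult'[symmetric] mult.commute)
  also have "\<dots> = ennreal (exp (l\<^sup>2 * \<sigma>\<^sup>2 / 2)) * (\<integral>\<^sup>+x. ennreal (normal_density (- l * \<sigma>\<^sup>2) \<sigma> x) \<partial>lborel)"
    by (rule nn_integral_cmult) auto
  also have "(\<integral>\<^sup>+x. ennreal (normal_density (- l * \<sigma>\<^sup>2) \<sigma> x) \<partial>lborel) = 1"
    using N.emeasure_space_1 by (simp add: emeasure_density)
  finally show ?thesis by simp
qed

lemma normal_density_le:
  assumes "\<sigma> > 0" shows "normal_density m \<sigma> x \<le> 1 / \<sigma>"
proof -
  have "1 \<le> sqrt (2 * pi)"
    using pi_gt3 by (simp add: real_le_rsqrt)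
  then have "\<sigma> \<le> sqrt (2 * pi * \<sigma>\<^sup>2)"
    using assms by (simp add: real_sqrt_mult)
  then have "1 / sqrt (2 * pi * \<sigma>\<^sup>2) \<le> 1 / \<sigma>"
    using assms by (simp add: frac_le)
  moreover have "exp (- (x - m)\<^sup>2 / (2 * \<sigma>\<^sup>2)) \<le> 1"
    by (simp add: divide_nonpos_nonneg)
  ultimately show ?thesis
    unfolding normal_density_def
    using mult_mono[of "1 / sqrt (2 * pi * \<sigma>\<^sup>2)" "1 / \<sigma>" "exp (- (x - m)\<^sup>2 / (2 * \<sigma>\<^sup>2))" 1] assms
    by simp
qed

text \<open>The tilted density is a multiple of a Gaussian density, hence bounded wherever the
  interval lies. Uniformity in the location is essential, because the interval will depend on the
  other increments.\<close>

lemma nn_integral_exp_normal_Icc_le: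
  assumes "\<sigma> > 0" "b \<le> b'"
  shows "(\<integral>\<^sup>+x. ennreal (exp (- l * x)) * indicator {b..b'} x \<partial>density lborel (normal_density 0 \<sigma>))
    \<le> ennreal ((b' - b) / \<sigma> * exp (l\<^sup>2 * \<sigma>\<^sup>2 / 2))"
proof -
  have "(\<integral>\<^sup>+x. ennreal (exp (- l * x)) * indicator {b..b'} x \<partial>density lborel (normal_density 0 \<sigma>))
    = (\<integral>\<^sup>+x. ennreal (normal_density 0 \<sigma> x) * (ennreal (exp (- l * x)) * indicator {b..b'} x) \<partial>lborel)"
    by (subst nn_integral_density) auto
  also have "\<dots> \<le> (\<integral>\<^sup>+x. ennreal (exp (l\<^sup>2 * \<sigma>\<^sup>2 / 2) / \<sigma>) * indicator {b..b'} x \<partial>lborel)"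
  proof (intro nn_integral_mono)
    fix x :: real
    have "normal_density 0 \<sigma> x * exp (- l * x) = exp (l\<^sup>2 * \<sigma>\<^sup>2 / 2) * normal_density (- l * \<sigma>\<^sup>2) \<sigma> x"
      using exp_tilt_normal_density[OF assms(1), of l x] by (simp add: mult.commute)
    also have "\<dots> \<le> exp (l\<^sup>2 * \<sigma>\<^sup>2 / 2) * (1 / \<sigma>)"
      by (intro mult_left_mono normal_density_le assms) auto
    finally have "ennreal (normal_density 0 \<sigma> x) * ennreal (exp (- l * x)) \<le> ennreal (exp (l\<^sup>2 * \<sigma>\<^sup>2 / 2) / \<sigma>)"
      by (simp add: ennreal_mult'[symmetric] ennreal_leI)
    then show "ennreal (normal_density 0 \<sigma> x) * (ennreal (exp (- l * x)) * indicator {b..b'} x)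
        \<le> ennreal (exp (l\<^sup>2 * \<sigma>\<^sup>2 / 2) / \<sigma>) * indicator {b..b'} x"
      by (auto simp: indicator_def)
  qed
  also have "\<dots> = ennreal (exp (l\<^sup>2 * \<sigma>\<^sup>2 / 2) / \<sigma>) * ennreal (b' - b)"
    using assms by (subst nn_integral_cmult_indicator) auto
  also have "\<dots> = ennreal ((b' - b) / \<sigma> * exp (l\<^sup>2 * \<sigma>\<^sup>2 / 2))"
    using assms by (subst ennreal_mult'[symmetric]) (auto simp: mult.commute)
  finally show ?thesis .
qed

abbreviation gaussian :: "real \<Rightarrow> real measure" where
  "gaussian \<sigma> \<equiv> density lborel (normal_density 0 \<sigma>)"

lemma product_sigma_finite_gaussian:
  assumes "\<And>i. s i > 0" shows "product_sigma_finite (\<lambda>i. gaussian (s i))"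
  unfolding product_sigma_finite_def
proof
  fix i
  interpret prob_space "gaussian (s i)" using assms by (rule prob_space_normal_density)
  show "sigma_finite_measure (gaussian (s i))" by (rule sigma_finite_measure_axioms)
qed

lemma product_prob_space_gaussian:
  assumes "\<And>i. s i > 0" shows "product_prob_space (\<lambda>i. gaussian (s i))"
  using assms by (intro product_prob_spaceI prob_space_normal_density) auto

lemma borel_measurable_component_gaussian [measurable]:
  "i \<in> I \<Longrightarrow> (\<lambda>x. x i) \<in> borel_measurable (\<Pi>\<^sub>M i\<in>I. gaussian (s i))"
  using measurable_component_singleton[of i I "\<lambda>i. gaussian (s i)"] by simp

lemma nn_integral_exp_sum_gaussian:
  fixes I :: "'i set"
  assumes fin: "finite I" and A: "A \<subseteq> I" and s: "\<And>i. s i > 0" "\<And>i. s i \<le> smax"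
  shows "(\<integral>\<^sup>+x. ennreal (exp (- l * (\<Sum>i\<in>A. x i))) \<partial>(\<Pi>\<^sub>M i\<in>I. gaussian (s i)))
    \<le> ennreal (exp (real (card A) * (l\<^sup>2 * smax\<^sup>2 / 2)))"
proof -
  interpret product_sigma_finite "\<lambda>i. gaussian (s i)"
    using s(1) by (rule product_sigma_finite_gaussian)
  have finA: "finite A" using fin A finite_subset by blast
  \<comment> \<open>Coordinates outside \<open>A\<close> get the factor 1, so that the product rule
    can be applied over all of \<open>I\<close>.\<close>
  have split: "(\<Prod>i\<in>I. if i \<in> A then f i else (1::ennreal)) = (\<Prod>i\<in>A. f i)" for f
    using A fin by (simp add: prod.If_cases Int_absorb1)
  have "(\<integral>\<^sup>+x. ennreal (exp (- l * (\<Sum>i\<in>A. x i))) \<partial>(\<Pi>\<^sub>M i\<in>I. gaussian (s i)))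
     = (\<integral>\<^sup>+x. (\<Prod>i\<in>I. (if i \<in> A then ennreal (exp (- l * x i)) else 1)) \<partial>(\<Pi>\<^sub>M i\<in>I. gaussian (s i)))"
    by (intro nn_integral_cong)
       (simp add: split sum_distrib_left sum_negf exp_sum[OF finA, symmetric] prod_ennreal)
  also have "\<dots> = (\<Prod>i\<in>I. \<integral>\<^sup>+y. (if i \<in> A then ennreal (exp (- l * y)) else 1) \<partial>gaussian (s i))"
    using fin by (subst product_nn_integral_prod) auto
  also have "\<dots> = (\<Prod>i\<in>I. if i \<in> A then ennreal (exp (l\<^sup>2 * (s i)\<^sup>2 / 2)) else 1)"
  proof (intro prod.cong refl)
    fix i
    have "prob_space (gaussian (s i))" using s(1) by (rule prob_space_normal_density)
    from prob_space.emeasure_space_1[OF this]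
    show "(\<integral>\<^sup>+y. (if i \<in> A then ennreal (exp (- l * y)) else 1) \<partial>gaussian (s i))
      = (if i \<in> A then ennreal (exp (l\<^sup>2 * (s i)\<^sup>2 / 2)) else 1)"
      using nn_integral_exp_normal[OF s(1)[of i], of l] by auto
  qed
  also have "\<dots> = (\<Prod>i\<in>A. ennreal (exp (l\<^sup>2 * (s i)\<^sup>2 / 2)))" by (rule split)
  also have "\<dots> = ennreal (\<Prod>i\<in>A. exp (l\<^sup>2 * (s i)\<^sup>2 / 2))" by (simp add: prod_ennreal)
  also have "\<dots> \<le> ennreal (\<Prod>i\<in>A. exp (l\<^sup>2 * smax\<^sup>2 / 2))"
  proof (intro ennreal_leI prod_mono conjI)
    fix i assume "i \<in> A"
    have "(s i)\<^sup>2 \<le> smax\<^sup>2" using s[of i] by (intro power_mono) auto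
    then show "exp (l\<^sup>2 * (s i)\<^sup>2 / 2) \<le> exp (l\<^sup>2 * smax\<^sup>2 / 2)"
      by (simp add: mult_left_mono)
  qed auto
  also have "(\<Prod>i\<in>A. exp (l\<^sup>2 * smax\<^sup>2 / 2)) = exp (real (card A) * (l\<^sup>2 * smax\<^sup>2 / 2))"
    by (simp add: exp_of_nat_mult[symmetric])
  finally show ?thesis .
qed

text \<open>Markov's inequality for the exponential of the sum; the tilt \<open>l\<close> stays free
  and is fixed only once the drift is known.\<close>

lemma gaussian_chernoff:
  fixes I :: "'i set"
  assumes fin: "finite I" and A: "A \<subseteq> I" and s: "\<And>i. s i > 0" "\<And>i. s i \<le> smax" and l: "l \<ge> 0"
  defines "P \<equiv> \<Pi>\<^sub>M i\<in>I. gaussian (s i)"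
  shows "emeasure P {x \<in> space P. (\<Sum>i\<in>A. x i) \<le> - u}
    \<le> ennreal (exp (- l * u + real (card A) * (l\<^sup>2 * smax\<^sup>2 / 2)))"
proof -
  have [measurable]: "i \<in> A \<Longrightarrow> (\<lambda>x. x i) \<in> borel_measurable P" for i
    unfolding P_def using A by (intro borel_measurable_component_gaussian) auto
  have "emeasure P {x \<in> space P. (\<Sum>i\<in>A. x i) \<le> - u}
    = (\<integral>\<^sup>+x. indicator {x \<in> space P. (\<Sum>i\<in>A. x i) \<le> - u} x \<partial>P)"
    by (subst nn_integral_indicator) auto
  also have "\<dots> \<le> (\<integral>\<^sup>+x. ennreal (exp (- l * u)) * ennreal (exp (- l * (\<Sum>i\<in>A. x i))) \<partial>P)"
  proof (intro nn_integral_mono)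
    fix x
    show "indicator {x \<in> space P. (\<Sum>i\<in>A. x i) \<le> - u} x
        \<le> ennreal (exp (- l * u)) * ennreal (exp (- l * (\<Sum>i\<in>A. x i)))"
    proof (cases "(\<Sum>i\<in>A. x i) \<le> - u")
      case True
      have "0 \<le> - l * u + - l * (\<Sum>i\<in>A. x i)"
        using mult_left_mono[OF True l] by simp
      then have "1 \<le> exp (- l * u) * exp (- l * (\<Sum>i\<in>A. x i))"
        by (simp flip: exp_add)
      then show ?thesis
        by (auto simp: indicator_def ennreal_mult'[symmetric])
    qed auto
  qed
  also have "\<dots> = ennreal (exp (- l * u)) * (\<integral>\<^sup>+x. ennreal (exp (- l * (\<Sum>i\<in>A. x i))) \<partial>P)"
    by (rule nn_integral_cmult) auto
  also have "\<dots> \<le> ennreal (exp (- l * u)) * ennreal (exp (real (card A) * (l\<^sup>2 * smax\<^sup>2 / 2)))"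
    unfolding P_def by (intro mult_left_mono nn_integral_exp_sum_gaussian assms) auto
  also have "\<dots> = ennreal (exp (- l * u + real (card A) * (l\<^sup>2 * smax\<^sup>2 / 2)))"
    by (simp add: ennreal_mult'[symmetric] flip: exp_add)
  finally show ?thesis .
qed

text \<open>Both constraints are charged at once. Coordinate \<open>i\<close> occurs in the sum over
  \<open>A\<close> but not in that over \<open>B\<close>, so with all other coordinates fixed the
  difference condition confines it to an interval of length \<open>v' - v\<close>. Its tilted
  integral gives the small factor, and the tilt of the remaining coordinates of \<open>A\<close>
  gives the rest of the Chernoff factor.\<close>

lemma gaussian_chernoff_small_ball:
  fixes I :: "'i set"
  assumes fin: "finite I" and A: "A \<subseteq> I" and B: "B \<subseteq> I" and i: "i \<in> A" "i \<notin> B"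
    and s: "\<And>i. s i \<ge> smin" "\<And>i. s i \<le> smax" "smin > 0" and l: "l \<ge> 0" and len: "v \<le> v'"
  defines "P \<equiv> \<Pi>\<^sub>M i\<in>I. gaussian (s i)"
  shows "emeasure P {x \<in> space P. (\<Sum>i\<in>A. x i) \<le> - u \<and> (\<Sum>i\<in>A. x i) - (\<Sum>i\<in>B. x i) \<in> {v..v'}}
    \<le> ennreal ((v' - v) / smin * exp (- l * u + real (card A) * (l\<^sup>2 * smax\<^sup>2 / 2)))"
proof -
  define I' where "I' = I - {i}"
  define A' where "A' = A - {i}"
  have I: "I = insert i I'" and I': "finite I'" "i \<notin> I'" using i A fin by (auto simp: I'_def)
  have A_eq: "A = insert i A'" and A': "i \<notin> A'" "A' \<subseteq> I'" "finite A'" and B': "B \<subseteq> I'"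
    using i A B fin by (auto simp: A'_def I'_def intro: finite_subset)
  have s0: "s i > 0" for i using s(1)[of i] s(3) by linarith
  interpret product_sigma_finite "\<lambda>i. gaussian (s i)"
    using s0 by (rule product_sigma_finite_gaussian)
  let ?E = "{x \<in> space P. (\<Sum>i\<in>A. x i) \<le> - u \<and> (\<Sum>i\<in>A. x i) - (\<Sum>i\<in>B. x i) \<in> {v..v'}}"
  let ?f = "\<lambda>x. ennreal (exp (- l * u)) * ennreal (exp (- l * (\<Sum>i\<in>A. x i)))
        * indicator {v..v'} ((\<Sum>i\<in>A. x i) - (\<Sum>i\<in>B. x i))"
  let ?q = "l\<^sup>2 * smax\<^sup>2 / 2"
  have [measurable]: "i \<in> A \<Longrightarrow> (\<lambda>x. x i) \<in> borel_measurable P"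
      "i \<in> B \<Longrightarrow> (\<lambda>x. x i) \<in> borel_measurable P" for i
    unfolding P_def using A B by (auto intro!: borel_measurable_component_gaussian)
  have f [measurable]: "?f \<in> borel_measurable P" by measurable
  have "emeasure P ?E = (\<integral>\<^sup>+x. indicator ?E x \<partial>P)"
    by (subst nn_integral_indicator) auto
  also have "\<dots> \<le> (\<integral>\<^sup>+x. ?f x \<partial>P)"
  proof (intro nn_integral_mono)
    fix x
    show "indicator ?E x \<le> ?f x"
    proof (cases "x \<in> ?E")
      case True
      have "0 \<le> - l * u + - l * (\<Sum>i\<in>A. x i)"
        using mult_left_mono[of "\<Sum>i\<in>A. x i" "- u" l] True l by simp
      then have "1 \<le> exp (- l * u) * exp (- l * (\<Sum>i\<in>A. x i))"
        by (simp flip: exp_add)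
      then show ?thesis
        using True by (simp add: indicator_def ennreal_mult'[symmetric])
    qed auto
  qed
  \<comment> \<open>Tonelli with coordinate \<open>i\<close> innermost: the rest of the
    configuration is frozen in \<open>x\<close>.\<close>
  also have "\<dots> = (\<integral>\<^sup>+x. (\<integral>\<^sup>+y. ?f (x(i := y)) \<partial>gaussian (s i)) \<partial>(\<Pi>\<^sub>M i\<in>I'. gaussian (s i)))"
    using product_nn_integral_insert[OF I'] f unfolding P_def I by blast
  also have "\<dots> \<le> (\<integral>\<^sup>+x. ennreal (exp (- l * u) * ((v' - v) / smin * exp ?q))
      * ennreal (exp (- l * (\<Sum>i\<in>A'. x i))) \<partial>(\<Pi>\<^sub>M i\<in>I'. gaussian (s i)))"
  proof (intro nn_integral_mono)
    fix x :: "'i \<Rightarrow> real"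
    let ?r = "\<Sum>i\<in>A'. x i" and ?t = "(\<Sum>i\<in>A'. x i) - (\<Sum>i\<in>B. x i)"
    have "(\<Sum>j\<in>A'. (x(i := y)) j) = ?r" for y
      using A' by (intro sum.cong) auto
    then have sums: "(\<Sum>j\<in>A. (x(i := y)) j) = y + ?r" "(\<Sum>j\<in>B. (x(i := y)) j) = (\<Sum>i\<in>B. x i)" for y
      using A' B' I'
      by (auto simp: A_eq simp del: fun_upd_apply) (auto intro!: sum.cong)
    \<comment> \<open>\<open>?t\<close> is the difference of the two sums without coordinate
      \<open>i\<close>; it merely shifts the interval.\<close>
    have "(\<integral>\<^sup>+y. ?f (x(i := y)) \<partial>gaussian (s i))
      = (\<integral>\<^sup>+y. ennreal (exp (- l * u) * exp (- l * ?r))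
          * (ennreal (exp (- l * y)) * indicator {v - ?t..v' - ?t} y) \<partial>gaussian (s i))"
      unfolding sums
      by (intro nn_integral_cong)
         (auto simp: indicator_def ennreal_mult'[symmetric] exp_add[symmetric] algebra_simps)
    also have "\<dots> = ennreal (exp (- l * u) * exp (- l * ?r))
        * (\<integral>\<^sup>+y. ennreal (exp (- l * y)) * indicator {v - ?t..v' - ?t} y \<partial>gaussian (s i))"
      by (rule nn_integral_cmult) auto
    also have "\<dots> \<le> ennreal (exp (- l * u) * exp (- l * ?r))
        * ennreal ((v' - v) / s i * exp (l\<^sup>2 * (s i)\<^sup>2 / 2))"
      using nn_integral_exp_normal_Icc_le[OF s0[of i], of "v - ?t" "v' - ?t" l] len
      by (intro mult_left_mono) auto
    also have "\<dots> \<le> ennreal (exp (- l * u) * exp (- l * ?r)) * ennreal ((v' - v) / smin * exp ?q)"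
    proof (intro mult_left_mono ennreal_leI mult_mono)
      show "(v' - v) / s i \<le> (v' - v) / smin"
        using s(1)[of i] s(3) len by (intro divide_left_mono) auto
      have "(s i)\<^sup>2 \<le> smax\<^sup>2" using s0[of i] s(2)[of i] by (intro power_mono) auto
      then show "exp (l\<^sup>2 * (s i)\<^sup>2 / 2) \<le> exp ?q" by (simp add: mult_left_mono)
    qed (use len s(3) in auto)
    also have "\<dots> = ennreal (exp (- l * u) * ((v' - v) / smin * exp ?q)) * ennreal (exp (- l * ?r))"
      using len s(3) by (simp add: ennreal_mult'[symmetric] mult_ac)
    finally show "(\<integral>\<^sup>+y. ?f (x(i := y)) \<partial>gaussian (s i))
      \<le> ennreal (exp (- l * u) * ((v' - v) / smin * exp ?q)) * ennreal (exp (- l * ?r))" .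
  qed
  also have "\<dots> = ennreal (exp (- l * u) * ((v' - v) / smin * exp ?q))
      * (\<integral>\<^sup>+x. ennreal (exp (- l * (\<Sum>i\<in>A'. x i))) \<partial>(\<Pi>\<^sub>M i\<in>I'. gaussian (s i)))"
  proof (rule nn_integral_cmult)
    have "i \<in> A' \<Longrightarrow> (\<lambda>x. x i) \<in> borel_measurable (\<Pi>\<^sub>M i\<in>I'. gaussian (s i))" for i
      using A' by (intro borel_measurable_component_gaussian) auto
    then show "(\<lambda>x. ennreal (exp (- l * (\<Sum>i\<in>A'. x i)))) \<in> borel_measurable (\<Pi>\<^sub>M i\<in>I'. gaussian (s i))"
      by measurable
  qed
  also have "\<dots> \<le> ennreal (exp (- l * u) * ((v' - v) / smin * exp ?q))
      * ennreal (exp (real (card A') * ?q))"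
    by (intro mult_left_mono nn_integral_exp_sum_gaussian I' A' s0 s) auto
  also have "\<dots> = ennreal ((v' - v) / smin * exp (- l * u + real (card A) * ?q))"
  proof -
    have "card A = Suc (card A')" using A' by (simp add: A_eq)
    then have "exp (- l * u + real (card A) * ?q) = exp (- l * u) * exp ?q * exp (real (card A') * ?q)"
      by (simp add: algebra_simps add_divide_distrib flip: exp_add)
    then show ?thesis using len s(3) by (simp add: ennreal_mult'[symmetric] mult_ac)
  qed
  finally show ?thesis .
qed

subsection \<open>Stable minimisers of the random walk\<close>

text \<open>Indices of the increments traversed from 0 to \<open>k\<close>. Index 0 belongs to the
  left half, as in \<open>walk\<close>, so a site \<open>k < 0\<close> uses
  \<open>{k + 1..0}\<close>.\<close>

definition steps :: "int \<Rightarrow> int set" where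
  "steps k = (if k > 0 then {1..k} else {k + 1..0})"

lemma finite_steps [simp]: "finite (steps k)"
  by (simp add: steps_def)

lemma card_steps [simp]: "card (steps k) = nat \<bar>k\<bar>"
  by (simp add: steps_def)

lemma walk_eq_sum_steps: "walk \<Delta> e k = \<bar>k\<bar> * \<Delta> / 2 + (\<Sum>i\<in>steps k. e i)"
proof (cases "k < 0")
  case True
  have "(\<Sum>i\<in>{0..\<bar>k\<bar> - 1}. e (- i)) = (\<Sum>i\<in>{k + 1..0}. e i)"
    using True by (intro sum.reindex_bij_witness[of _ uminus uminus]) auto
  then show ?thesis using True by (simp add: walk_def steps_def)
qed (auto simp: walk_def steps_def)

lemma walk_0 [simp]: "walk \<Delta> e 0 = 0"
  by (simp add: walk_def)

text \<open>The outermost increment of the farther site is a witness. Sites on opposite sides share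
  no increment, so equal moduli cause no trouble.\<close>

lemma steps_diff_nonempty:
  assumes "\<bar>n\<bar> \<le> \<bar>m\<bar>" "m \<noteq> n"
  shows "\<exists>i \<in> steps m. i \<notin> steps n"
proof (cases "m > 0")
  case True
  then show ?thesis using assms by (intro bexI[of _ m]) (auto simp: steps_def)
next
  case False
  then show ?thesis using assms by (intro bexI[of _ "m + 1"]) (auto simp: steps_def)
qed

text \<open>The margin grows with the distance from the origin, so that the minimiser survives a change of
  the drift by \<open>\<eta>\<close> on either side.\<close>

definition clear_min :: "real \<Rightarrow> real \<Rightarrow> int set \<Rightarrow> (int \<Rightarrow> real) \<Rightarrow> int \<Rightarrow> bool" where
  "clear_min \<Delta> \<eta> T e L \<longleftrightarrow>
     (\<forall>k\<in>T - {L}. walk \<Delta> e k - walk \<Delta> e L > \<eta> * (\<bar>k\<bar> + \<bar>L\<bar>))"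

text \<open>Here \<open>l\<close> is the candidate minimiser and \<open>k\<close> its rival. The
  clause \<open>walk \<Delta> e l \<le> 0\<close> costs nothing, since a minimiser cannot exceed the
  value 0 at the origin, and it supplies the exponential decay.\<close>

definition near_tie :: "real \<Rightarrow> real \<Rightarrow> (int \<Rightarrow> real) \<Rightarrow> int \<Rightarrow> int \<Rightarrow> bool" where
  "near_tie \<Delta> \<eta> e k l \<longleftrightarrow>
     walk \<Delta> e l \<le> 0 \<and> 0 \<le> walk \<Delta> e k - walk \<Delta> e l \<and>
     walk \<Delta> e k - walk \<Delta> e l \<le> \<eta> * (\<bar>k\<bar> + \<bar>l\<bar>)"

text \<open>A minimiser over \<open>{- int R..int R}\<close> has value at most 0, so the positive
  values outside cannot beat it; the absence of near ties then turns minimality into the required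
  margin.\<close>

lemma clear_min_exists:
  assumes tail: "\<And>k. \<bar>k\<bar> > int R \<Longrightarrow> walk \<Delta> e k > 0"
    and ties: "\<And>k l. k \<noteq> l \<Longrightarrow> \<not> near_tie \<Delta> \<eta> e k l"
  shows "\<exists>L. \<bar>L\<bar> \<le> int R \<and> clear_min \<Delta> \<eta> UNIV e L"
proof -
  let ?T = "{- int R..int R}"
  have "finite ?T" "?T \<noteq> {}" by auto
  from arg_min_if_finite[OF this, of "walk \<Delta> e"]
  obtain L where L: "L \<in> ?T" "\<And>k. k \<in> ?T \<Longrightarrow> walk \<Delta> e L \<le> walk \<Delta> e k"
    by (meson not_less)
  have "walk \<Delta> e L \<le> 0" using L(2)[of 0] by simp
  moreover have "walk \<Delta> e L \<le> walk \<Delta> e k" for k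
    using L(2)[of k] tail[of k] \<open>walk \<Delta> e L \<le> 0\<close> by (cases "k \<in> ?T") (auto simp: abs_le_iff not_le)
  ultimately have "clear_min \<Delta> \<eta> UNIV e L"
    using ties[of _ L] by (auto simp: clear_min_def near_tie_def not_le)
  then show ?thesis using L(1) by (intro exI[of _ L]) auto
qed

lemma prob_space_walk_noise: "\<sigma>1 > 0 \<Longrightarrow> \<sigma>2 > 0 \<Longrightarrow> prob_space (walk_noise \<sigma>1 \<sigma>2)"
  unfolding walk_noise_def by (intro prob_space_PiM prob_space_normal_density) auto

lemma sets_walk_noise: "sets (walk_noise \<sigma>1 \<sigma>2) = sets (\<Pi>\<^sub>M i\<in>UNIV. borel)"
  unfolding walk_noise_def by (intro sets_PiM_cong) auto

lemma borel_measurable_walk_noise_component [measurable]: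
  "(\<lambda>e. e i) \<in> borel_measurable (walk_noise \<sigma>1 \<sigma>2)"
  by (subst measurable_cong_sets[OF sets_walk_noise refl]) measurable

lemma borel_measurable_walk [measurable]:
  "(\<lambda>e. walk \<Delta> e k) \<in> borel_measurable (walk_noise \<sigma>1 \<sigma>2)"
  unfolding walk_eq_sum_steps by measurable

text \<open>Replaces the infinite product by a finite marginal, to which the Tonelli bounds apply;
  \<open>cyl\<close> says that \<open>P\<close> reads only coordinates in \<open>I\<close>.\<close>

lemma emeasure_walk_noise_cylinder:
  assumes "finite I" "\<sigma>1 > 0" "\<sigma>2 > 0"
    and cyl: "\<And>e. P (restrict e I) \<longleftrightarrow> P e"
    and meas: "{x \<in> space (\<Pi>\<^sub>M i\<in>I. borel). P x} \<in> sets (\<Pi>\<^sub>M i\<in>I. borel)"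
  defines "Q \<equiv> \<Pi>\<^sub>M i\<in>I. gaussian (if i \<le> 0 then \<sigma>1 else \<sigma>2)"
  shows "emeasure (walk_noise \<sigma>1 \<sigma>2) {e \<in> space (walk_noise \<sigma>1 \<sigma>2). P e} = emeasure Q {x \<in> space Q. P x}"
proof -
  let ?s = "\<lambda>i::int. if i \<le> 0 then \<sigma>1 else \<sigma>2"
  interpret product_prob_space "\<lambda>i. gaussian (?s i)" UNIV
    using assms by (intro product_prob_space_gaussian) auto
  have sets: "sets Q = sets (\<Pi>\<^sub>M i\<in>I. borel)" unfolding Q_def by (intro sets_PiM_cong) auto
  then have space: "space Q = space (\<Pi>\<^sub>M i\<in>I. borel)" by (rule sets_eq_imp_space_eq)
  have Q: "Q = distr (walk_noise \<sigma>1 \<sigma>2) Q (\<lambda>e. restrict e I)"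
    unfolding Q_def walk_noise_def using assms(1) distr_PiM_restrict_finite[of I] by simp
  have restr: "(\<lambda>e. restrict e I) \<in> measurable (walk_noise \<sigma>1 \<sigma>2) Q"
    unfolding Q_def walk_noise_def by (intro measurable_restrict_subset) auto
  have "emeasure Q {x \<in> space Q. P x}
    = emeasure (walk_noise \<sigma>1 \<sigma>2) ((\<lambda>e. restrict e I) -` {x \<in> space Q. P x} \<inter> space (walk_noise \<sigma>1 \<sigma>2))"
    by (subst Q, rule emeasure_distr[OF restr]) (use meas sets space in auto)
  also have "(\<lambda>e. restrict e I) -` {x \<in> space Q. P x} \<inter> space (walk_noise \<sigma>1 \<sigma>2)
      = {e \<in> space (walk_noise \<sigma>1 \<sigma>2). P e}"
    using cyl measurable_space[OF restr] by auto
  finally show ?thesis ..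
qed

text \<open>Drift and variances enter only through common bounds, so that the constants
  \<open>rate\<close> and \<open>unclear_const\<close> are the same at every change point and every
  sample size.\<close>

locale walk_bounds =
  fixes D0 smin smax \<Delta> \<sigma>1 \<sigma>2 :: real
  assumes D0: "D0 > 0" "D0 \<le> \<Delta>"
    and smin: "smin > 0"
    and \<sigma>: "smin \<le> \<sigma>1" "\<sigma>1 \<le> smax" "smin \<le> \<sigma>2" "\<sigma>2 \<le> smax"
begin

abbreviation "W \<equiv> walk_noise \<sigma>1 \<sigma>2"
abbreviation "s \<equiv> (\<lambda>i::int. if i \<le> 0 then \<sigma>1 else \<sigma>2)"

text \<open>The exponent per step left by the tilt \<open>D0 / (4 * smax\<^sup>2)\<close>, half the
  optimal one: in units of \<open>D0\<^sup>2 / (32 * smax\<^sup>2)\<close> the drift gains 4, the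
  variance costs 1 and the largest allowed perturbation of the drift costs 1.\<close>

definition rate :: real where "rate = D0\<^sup>2 / (16 * smax\<^sup>2)"

lemma \<sigma>_pos: "\<sigma>1 > 0" "\<sigma>2 > 0" "smax > 0"
  using smin \<sigma> by linarith+

sublocale W: prob_space W
  using \<sigma>_pos by (intro prob_space_walk_noise)

text \<open>The tilt \<open>D0 / (4 smax\<^sup>2)\<close> leaves room for a perturbation of the drift by up to \<open>D0 / 8\<close>.\<close>

lemma tilt_exponent:
  assumes "\<eta> \<le> D0 / 16" "m \<ge> 0"
  shows "- (D0 / (4 * smax\<^sup>2)) * (m * \<Delta> / 2 - 2 * \<eta> * m) + m * ((D0 / (4 * smax\<^sup>2))\<^sup>2 * smax\<^sup>2 / 2)
    \<le> - rate * m"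
proof -
  define l where "l = D0 / (4 * smax\<^sup>2)"
  have l: "l \<ge> 0" using D0 by (simp add: l_def)
  have 1: "l\<^sup>2 * smax\<^sup>2 / 2 = l * D0 / 8" and 2: "rate = l * D0 / 4"
    using \<sigma>_pos by (simp_all add: l_def rate_def field_simps power2_eq_square)
  have "0 \<le> l * m * ((\<Delta> - D0) / 2 + (D0 / 8 - 2 * \<eta>))"
    using l assms D0 by (intro mult_nonneg_nonneg) auto
  then show ?thesis unfolding l_def[symmetric] 1 2 by (simp add: field_simps)
qed

lemma walk_nonpos_prob:
  "W.prob {e \<in> space W. walk \<Delta> e k \<le> 0} \<le> exp (- rate * \<bar>k\<bar>)"
proof -
  let ?P = "\<lambda>I. \<Pi>\<^sub>M i\<in>I. gaussian (s i)" and ?l = "D0 / (4 * smax\<^sup>2)"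
  let ?u = "\<bar>k\<bar> * \<Delta> / 2"
  have "emeasure W {e \<in> space W. walk \<Delta> e k \<le> 0}
    = emeasure (?P (steps k)) {x \<in> space (?P (steps k)). walk \<Delta> x k \<le> 0}"
    using \<sigma>_pos by (intro emeasure_walk_noise_cylinder) (auto simp: walk_eq_sum_steps)
  also have "\<dots> = emeasure (?P (steps k)) {x \<in> space (?P (steps k)). (\<Sum>i\<in>steps k. x i) \<le> - ?u}"
    by (intro arg_cong[where f = "emeasure _"]) (auto simp: walk_eq_sum_steps)
  also have "\<dots> \<le> ennreal (exp (- ?l * ?u + real (card (steps k)) * (?l\<^sup>2 * smax\<^sup>2 / 2)))"
    using \<sigma> \<sigma>_pos D0 by (intro gaussian_chernoff) auto
  also have "\<dots> \<le> ennreal (exp (- rate * \<bar>k\<bar>))"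
    using tilt_exponent[of 0 "\<bar>k\<bar>"] D0 by (intro ennreal_leI) auto
  finally show ?thesis by (simp add: W.emeasure_eq_measure)
qed

text \<open>The farther site \<open>m\<close> owns an increment that \<open>n\<close> lacks, and
  this one is integrated out. The slack \<open>2 * \<eta> * \<bar>m\<bar>\<close> covers the case
  that \<open>m\<close> is the rival in a near tie, which is low only up to the tie margin.\<close>

lemma increment_small_ball_prob:
  assumes mn: "\<bar>n\<bar> \<le> \<bar>m\<bar>" "m \<noteq> n" and \<eta>: "\<eta> \<le> D0 / 16" and v: "v \<le> v'"
  shows "W.prob {e \<in> space W. walk \<Delta> e m \<le> 2 * \<eta> * \<bar>m\<bar> \<and> walk \<Delta> e m - walk \<Delta> e n \<in> {v..v'}}
    \<le> (v' - v) / smin * exp (- rate * \<bar>m\<bar>)"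
proof -
  let ?I = "steps m \<union> steps n"
  let ?P = "\<Pi>\<^sub>M i\<in>?I. gaussian (s i)" and ?l = "D0 / (4 * smax\<^sup>2)"
  let ?u = "\<bar>m\<bar> * \<Delta> / 2 - 2 * \<eta> * \<bar>m\<bar>" and ?c = "\<bar>m\<bar> * \<Delta> / 2 - \<bar>n\<bar> * \<Delta> / 2"
  let ?Q = "\<lambda>e. walk \<Delta> e m \<le> 2 * \<eta> * \<bar>m\<bar> \<and> walk \<Delta> e m - walk \<Delta> e n \<in> {v..v'}"
  obtain i where i: "i \<in> steps m" "i \<notin> steps n" using steps_diff_nonempty[OF mn] by auto
  have sum_eq: "(\<Sum>i\<in>steps m. restrict e ?I i) = (\<Sum>i\<in>steps m. e i)"
     "(\<Sum>i\<in>steps n. restrict e ?I i) = (\<Sum>i\<in>steps n. e i)" for e :: "int \<Rightarrow> real"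
    by (auto intro!: sum.cong)
  have "emeasure W {e \<in> space W. ?Q e} = emeasure ?P {x \<in> space ?P. ?Q x}"
  proof (intro emeasure_walk_noise_cylinder \<sigma>_pos)
    have [measurable]: "i \<in> steps m \<Longrightarrow> (\<lambda>x. x i) \<in> borel_measurable (Pi\<^sub>M ?I (\<lambda>_. borel :: real measure))"
        "i \<in> steps n \<Longrightarrow> (\<lambda>x. x i) \<in> borel_measurable (Pi\<^sub>M ?I (\<lambda>_. borel :: real measure))" for i
      by measurable
    show "{x \<in> space (Pi\<^sub>M ?I (\<lambda>_. borel)). ?Q x} \<in> sets (Pi\<^sub>M ?I (\<lambda>_. borel))"
      unfolding walk_eq_sum_steps by measurable
  qed (auto simp: walk_eq_sum_steps sum_eq)
  also have "\<dots> = emeasure ?P {x \<in> space ?P. (\<Sum>i\<in>steps m. x i) \<le> - ?u \<and>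
      (\<Sum>i\<in>steps m. x i) - (\<Sum>i\<in>steps n. x i) \<in> {v - ?c..v' - ?c}}"
    by (intro arg_cong[where f = "emeasure _"]) (auto simp: walk_eq_sum_steps)
  also have "\<dots> \<le> ennreal (((v' - ?c) - (v - ?c)) / smin
      * exp (- ?l * ?u + real (card (steps m)) * (?l\<^sup>2 * smax\<^sup>2 / 2)))"
    using \<sigma> smin D0 v i by (intro gaussian_chernoff_small_ball) auto
  also have "\<dots> \<le> ennreal ((v' - v) / smin * exp (- rate * \<bar>m\<bar>))"
    using tilt_exponent[OF \<eta>, of "\<bar>m\<bar>"] v smin by (intro ennreal_leI mult_mono) auto
  finally show ?thesis using v smin by (simp add: W.emeasure_eq_measure)
qed

lemma near_tie_prob:
  assumes kl: "k \<noteq> l" and \<eta>: "0 \<le> \<eta>" "\<eta> \<le> D0 / 16" and n: "max \<bar>k\<bar> \<bar>l\<bar> = int n"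
  shows "W.prob {e \<in> space W. near_tie \<Delta> \<eta> e k l} \<le> 2 * \<eta> * real n / smin * exp (- rate * real n)"
proof -
  let ?len = "\<eta> * (\<bar>k\<bar> + \<bar>l\<bar>)"
  have len: "0 \<le> ?len" "?len \<le> 2 * \<eta> * real n"
  proof -
    have "real_of_int (\<bar>k\<bar> + \<bar>l\<bar>) \<le> real_of_int (2 * int n)" using n by linarith
    from mult_left_mono[OF this \<eta>(1)] show "?len \<le> 2 * \<eta> * real n" by simp
  qed (use \<eta> in auto)
  let ?inc = "\<lambda>m m' v e. walk \<Delta> e m \<le> 2 * \<eta> * \<bar>m\<bar> \<and> walk \<Delta> e m - walk \<Delta> e m' \<in> {v..v + ?len}"
  obtain m m' v where m: "\<bar>m'\<bar> \<le> \<bar>m\<bar>" "m \<noteq> m'" "\<bar>m\<bar> = int n"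
    and sub: "\<And>e. near_tie \<Delta> \<eta> e k l \<Longrightarrow> ?inc m m' v e"
  \<comment> \<open>The increment to integrate out must belong to the farther site. If that is the
    rival \<open>k\<close>, its value is at most the margin and the difference lies in
    \<open>{0..?len}\<close>; if it is the candidate \<open>l\<close>, its value is nonpositive and
    the reversed difference lies in \<open>{- ?len..0}\<close>.\<close>
  proof (cases "\<bar>l\<bar> \<le> \<bar>k\<bar>")
    case True
    then have k: "\<bar>k\<bar> = int n" using n by simp
    then have rk: "real_of_int \<bar>k\<bar> = real n" by simp
    have "?inc k l 0 e" if "near_tie \<Delta> \<eta> e k l" for e
      using that len unfolding near_tie_def rk by simp
    then show thesis using that True kl k by blast
  next
    case False
    then have l: "\<bar>l\<bar> = int n" using n by simp
    then have rl: "real_of_int \<bar>l\<bar> = real n" by simp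
    have "0 \<le> 2 * \<eta> * real n" using \<eta> by simp
    then have "?inc l k (- ?len) e" if "near_tie \<Delta> \<eta> e k l" for e
      using that len unfolding near_tie_def rl atLeastAtMost_iff by linarith
    moreover have "\<bar>k\<bar> \<le> \<bar>l\<bar>" using False by simp
    ultimately show thesis using that kl l by blast
  qed
  have "W.prob {e \<in> space W. near_tie \<Delta> \<eta> e k l}
    \<le> W.prob {e \<in> space W. walk \<Delta> e m \<le> 2 * \<eta> * \<bar>m\<bar> \<and> walk \<Delta> e m - walk \<Delta> e m' \<in> {v..v + ?len}}"
  proof (rule W.finite_measure_mono)
    show "{e \<in> space W. near_tie \<Delta> \<eta> e k l} \<subseteq> {e \<in> space W. ?inc m m' v e}"
      using sub by blast
    have "{e \<in> space W. walk \<Delta> e m \<le> 2 * \<eta> * \<bar>m\<bar>} \<in> sets W" 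
      "{e \<in> space W. v \<le> walk \<Delta> e m - walk \<Delta> e m'} \<in> sets W"
      "{e \<in> space W. walk \<Delta> e m - walk \<Delta> e m' \<le> v + ?len} \<in> sets W"
      by (intro borel_measurable_le borel_measurable_diff borel_measurable_walk borel_measurable_const)+
    from sets.Int[OF this(1) sets.Int[OF this(2,3)]]
    show "{e \<in> space W. ?inc m m' v e} \<in> sets W"
      by (rule back_subst[of "\<lambda>A. A \<in> sets W"]) auto
  qed
  also have "\<dots> \<le> (v + ?len - v) / smin * exp (- rate * \<bar>m\<bar>)"
    using len by (intro increment_small_ball_prob m \<eta>) auto
  also have "\<dots> \<le> 2 * \<eta> * real n / smin * exp (- rate * real n)"
  proof (intro mult_mono divide_right_mono)
    have "real_of_int \<bar>m\<bar> = real n" using m(3) by simp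
    then show "exp (- rate * \<bar>m\<bar>) \<le> exp (- rate * real n)" by simp
  qed (use len smin in auto)
  finally show ?thesis .
qed

end

section \<open>Union bound over all pairs of sites\<close>

lemma summable_poly_exp:
  fixes c :: real assumes "c > 0"
  shows "summable (\<lambda>n. real ((2 * n + 1)\<^sup>2) * (2 * real n * exp (- c * real n)))"
proof (rule summable_comparison_test_bigo)
  show "summable (\<lambda>n. norm (1 / real n ^ 2))"
    using inverse_power_summable[of 2] by (simp add: inverse_eq_divide)
  show "(\<lambda>n. real ((2 * n + 1)\<^sup>2) * (2 * real n * exp (- c * real n))) \<in> O(\<lambda>n. 1 / real n ^ 2)"
    using assms by real_asymp
qed

lemma summable_exp_neg:
  fixes c :: real assumes "c > 0"
  shows "summable (\<lambda>n. 2 * exp (- c * real n))"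
proof (rule summable_comparison_test_bigo)
  show "summable (\<lambda>n. norm (1 / real n ^ 2))"
    using inverse_power_summable[of 2] by (simp add: inverse_eq_divide)
  show "(\<lambda>n. 2 * exp (- c * real n)) \<in> O(\<lambda>n. 1 / real n ^ 2)"
    using assms by real_asymp
qed

context walk_bounds
begin

text \<open>First sum: the at most \<open>(2 * n + 1)\<^sup>2\<close> pairs with larger modulus
  \<open>n\<close>, each with a tie interval of length at most \<open>2 * n * \<eta>\<close>, the
  factor \<eta> being taken out. Second sum: the two sites at each distance beyond the search
  radius.\<close>

definition unclear_const :: real where
  "unclear_const = (\<Sum>n. real ((2 * n + 1)\<^sup>2) * (2 * real n * exp (- rate * real n))) / smin
     + (\<Sum>n. 2 * exp (- rate * real n))"

lemma rate_pos: "rate > 0"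
  using D0 \<sigma>_pos by (simp add: rate_def)

lemma near_tie_sets: "{e \<in> space W. near_tie \<Delta> \<eta> e k l} \<in> sets W"
proof -
  have "{e \<in> space W. walk \<Delta> e l \<le> 0} \<in> sets W" 
    "{e \<in> space W. 0 \<le> walk \<Delta> e k - walk \<Delta> e l} \<in> sets W"
    "{e \<in> space W. walk \<Delta> e k - walk \<Delta> e l \<le> \<eta> * (\<bar>k\<bar> + \<bar>l\<bar>)} \<in> sets W"
    by (intro borel_measurable_le borel_measurable_diff borel_measurable_walk borel_measurable_const)+
  from sets.Int[OF this(1) sets.Int[OF this(2,3)]] show ?thesis
    by (rule back_subst[of "\<lambda>A. A \<in> sets W"]) (auto simp: near_tie_def)
qed

lemma clear_min_prob:
  assumes \<eta>: "0 \<le> \<eta>" "\<eta> \<le> D0 / 16"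
  shows "W.prob {e \<in> space W. \<not> (\<exists>L. \<bar>L\<bar> \<le> int R \<and> clear_min \<Delta> \<eta> UNIV e L)}
    \<le> unclear_const * (\<eta> + exp (- rate * real R))"
proof -
  \<comment> \<open>Grouping by the larger modulus makes each group finite and its probability bound
    a function of \<open>n\<close> alone.\<close>
  define pairs where "pairs n = {(k, l). k \<noteq> l \<and> max \<bar>k\<bar> \<bar>l\<bar> = int n}" for n :: nat
  define ties where "ties n = (\<Union>(k, l)\<in>pairs n. {e \<in> space W. near_tie \<Delta> \<eta> e k l})" for n
  \<comment> \<open>The tail starts at distance \<open>R + 1\<close>, so
    \<open>exp (- rate * real R)\<close> factors out of the whole series.\<close>
  define tail where "tail n = (\<Union>k\<in>{int (Suc R + n), - int (Suc R + n)}. {e \<in> space W. walk \<Delta> e k \<le> 0})" for n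
  let ?a = "\<lambda>n. real ((2 * n + 1)\<^sup>2) * (2 * real n * exp (- rate * real n))"
  have pairs: "finite (pairs n)" "real (card (pairs n)) \<le> real ((2 * n + 1)\<^sup>2)" for n
  proof -
    let ?S = "{- int n..int n} \<times> {- int n..int n}"
    have sub: "pairs n \<subseteq> ?S" by (auto simp: pairs_def)
    show "finite (pairs n)" using sub by (rule finite_subset) auto
    have "card (pairs n) \<le> card ?S" using sub by (intro card_mono) auto
    also have "\<dots> = (2 * n + 1)\<^sup>2" by (simp add: card_cartesian_product power2_eq_square nat_add_distrib nat_mult_distrib)
    finally show "real (card (pairs n)) \<le> real ((2 * n + 1)\<^sup>2)" by (rule of_nat_mono)
  qed
  have tail_sets: "{e \<in> space W. walk \<Delta> e k \<le> 0} \<in> sets W" for k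
    by (intro borel_measurable_le borel_measurable_walk borel_measurable_const)
  have near_tie_sets': "(case p of (k, l) \<Rightarrow> {e \<in> space W. near_tie \<Delta> \<eta> e k l}) \<in> sets W" for p
    by (cases p) (simp only: prod.case near_tie_sets)
  have ties_sets: "range ties \<subseteq> sets W"
    unfolding ties_def by (intro image_subsetI sets.finite_UN pairs(1) near_tie_sets')
  have tails_sets: "range tail \<subseteq> sets W"
    unfolding tail_def by (intro image_subsetI sets.finite_UN tail_sets finite.intros)
  have ties: "W.prob (ties n) \<le> \<eta> / smin * ?a n" for n
  proof -
    have "W.prob (ties n) \<le> (\<Sum>p\<in>pairs n. W.prob (case p of (k, l) \<Rightarrow> {e \<in> space W. near_tie \<Delta> \<eta> e k l}))"
      unfolding ties_def
      by (intro W.finite_measure_subadditive_finite pairs(1) image_subsetI near_tie_sets')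
    also have "\<dots> \<le> (\<Sum>p\<in>pairs n. 2 * \<eta> * real n / smin * exp (- rate * real n))"
    proof (intro sum_mono)
      fix p assume "p \<in> pairs n"
      then obtain k l where p: "p = (k, l)" "k \<noteq> l" "max \<bar>k\<bar> \<bar>l\<bar> = int n"
        unfolding pairs_def by blast
      show "W.prob (case p of (k, l) \<Rightarrow> {e \<in> space W. near_tie \<Delta> \<eta> e k l})
        \<le> 2 * \<eta> * real n / smin * exp (- rate * real n)"
        unfolding p(1) prod.case using p(2) \<eta> p(3) by (rule near_tie_prob)
    qed
    also have "\<dots> = real (card (pairs n)) * (2 * \<eta> * real n / smin * exp (- rate * real n))" by simp
    also have "\<dots> \<le> real ((2 * n + 1)\<^sup>2) * (2 * \<eta> * real n / smin * exp (- rate * real n))"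
      using \<eta> smin by (intro mult_right_mono pairs) auto
    also have "\<dots> = \<eta> / smin * ?a n" by simp
    finally show ?thesis .
  qed
  have tail: "W.prob (tail n) \<le> exp (- rate * real R) * (2 * exp (- rate * real n))" for n
  proof -
    have "W.prob (tail n) \<le> (\<Sum>k\<in>{int (Suc R + n), - int (Suc R + n)}. W.prob {e \<in> space W. walk \<Delta> e k \<le> 0})"
      unfolding tail_def
      by (intro W.finite_measure_subadditive_finite image_subsetI tail_sets finite.intros)
    also have "\<dots> \<le> (\<Sum>k\<in>{int (Suc R + n), - int (Suc R + n)}. exp (- rate * \<bar>k\<bar>))"
      by (intro sum_mono walk_nonpos_prob)
    also have "\<dots> = 2 * exp (- rate * real (Suc R + n))" by simp
    also have "\<dots> \<le> 2 * exp (- rate * (real R + real n))"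
      using rate_pos by simp
    also have "\<dots> = exp (- rate * real R) * (2 * exp (- rate * real n))"
      by (simp add: distrib_left mult_exp_exp)
    finally show ?thesis .
  qed
  have sum_ties: "W.prob (\<Union>n. ties n) \<le> \<eta> / smin * (\<Sum>n. ?a n)"
  proof -
    have sm: "summable (\<lambda>n. \<eta> / smin * ?a n)" by (intro summable_mult summable_poly_exp rate_pos)
    have sm': "summable (\<lambda>n. W.prob (ties n))"
      by (rule summable_comparison_test[OF _ sm]) (use ties in auto)
    have "W.prob (\<Union>n. ties n) \<le> (\<Sum>n. W.prob (ties n))"
      using sm' ties_sets by (intro W.finite_measure_subadditive_countably)
    also have "\<dots> \<le> (\<Sum>n. \<eta> / smin * ?a n)" by (intro suminf_le ties sm sm')
    also have "\<dots> = \<eta> / smin * (\<Sum>n. ?a n)" by (intro suminf_mult summable_poly_exp rate_pos)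
    finally show ?thesis .
  qed
  have sum_tail: "W.prob (\<Union>n. tail n) \<le> exp (- rate * real R) * (\<Sum>n. 2 * exp (- rate * real n))"
  proof -
    have sm: "summable (\<lambda>n. exp (- rate * real R) * (2 * exp (- rate * real n)))"
      by (rule summable_mult[OF summable_exp_neg[OF rate_pos]])
    have sm': "summable (\<lambda>n. W.prob (tail n))"
      by (rule summable_comparison_test[OF _ sm]) (use tail in auto)
    have "W.prob (\<Union>n. tail n) \<le> (\<Sum>n. W.prob (tail n))"
      using sm' tails_sets by (intro W.finite_measure_subadditive_countably)
    also have "\<dots> \<le> (\<Sum>n. exp (- rate * real R) * (2 * exp (- rate * real n)))" by (intro suminf_le tail sm sm')
    also have "\<dots> = exp (- rate * real R) * (\<Sum>n. 2 * exp (- rate * real n))"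
      by (rule suminf_mult[OF summable_exp_neg[OF rate_pos]])
    finally show ?thesis .
  qed
  have "{e \<in> space W. \<not> (\<exists>L. \<bar>L\<bar> \<le> int R \<and> clear_min \<Delta> \<eta> UNIV e L)} \<subseteq> (\<Union>n. ties n) \<union> (\<Union>n. tail n)"
  proof
    fix e assume e: "e \<in> {e \<in> space W. \<not> (\<exists>L. \<bar>L\<bar> \<le> int R \<and> clear_min \<Delta> \<eta> UNIV e L)}"
    then consider k where "\<bar>k\<bar> > int R" "walk \<Delta> e k \<le> 0" | k l where "k \<noteq> l" "near_tie \<Delta> \<eta> e k l"
      using clear_min_exists[of R \<Delta> e \<eta>] by (metis (mono_tags, lifting) mem_Collect_eq not_less)
    then show "e \<in> (\<Union>n. ties n) \<union> (\<Union>n. tail n)"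
    proof cases
      case 1
      then have "\<bar>k\<bar> = int (Suc R + nat (\<bar>k\<bar> - int (Suc R)))" by simp
      then have "k \<in> {int (Suc R + nat (\<bar>k\<bar> - int (Suc R))), - int (Suc R + nat (\<bar>k\<bar> - int (Suc R)))}"
        by (auto simp: abs_if split: if_splits)
      then have "e \<in> tail (nat (\<bar>k\<bar> - int (Suc R)))"
        unfolding tail_def using e 1 by blast
      then show ?thesis by blast
    next
      case 2
      then have "(k, l) \<in> pairs (nat (max \<bar>k\<bar> \<bar>l\<bar>))" by (auto simp: pairs_def)
      then have "e \<in> ties (nat (max \<bar>k\<bar> \<bar>l\<bar>))"
        unfolding ties_def using e 2 by blast
      then show ?thesis by blast
    qed
  qed
  moreover have U_sets: "(\<Union>n. ties n) \<in> sets W" "(\<Union>n. tail n) \<in> sets W"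
    by (intro sets.countable_nat_UN ties_sets tails_sets)+
  ultimately have "W.prob {e \<in> space W. \<not> (\<exists>L. \<bar>L\<bar> \<le> int R \<and> clear_min \<Delta> \<eta> UNIV e L)}
      \<le> W.prob ((\<Union>n. ties n) \<union> (\<Union>n. tail n))"
    by (intro W.finite_measure_mono sets.Un)
  also have "\<dots> \<le> W.prob (\<Union>n. ties n) + W.prob (\<Union>n. tail n)"
    by (intro measure_Un_le U_sets)
  also have "\<dots> \<le> \<eta> / smin * (\<Sum>n. ?a n) + exp (- rate * real R) * (\<Sum>n. 2 * exp (- rate * real n))"
    by (intro add_mono sum_ties sum_tail)
  also have "\<dots> \<le> unclear_const * (\<eta> + exp (- rate * real R))"
  proof -
    define A B E where "A = (\<Sum>n. ?a n) / smin" and "B = (\<Sum>n. 2 * exp (- rate * real n))"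
      and "E = exp (- rate * real R)"
    have "0 \<le> A" unfolding A_def
      using smin by (intro divide_nonneg_pos suminf_nonneg summable_poly_exp rate_pos) auto
    moreover have "0 \<le> B" unfolding B_def
      by (rule suminf_nonneg[OF summable_exp_neg[OF rate_pos]]) auto
    \<comment> \<open>The cross terms are nonnegative, so one constant serves both errors.\<close>
    ultimately have "\<eta> * A + E * B \<le> (A + B) * (\<eta> + E)"
      using \<eta> by (simp add: algebra_simps E_def)
    then show ?thesis unfolding unclear_const_def A_def B_def E_def by simp
  qed
  finally show ?thesis .
qed

end

section \<open>Uniqueness and measurability of minimisers\<close>

lemma clear_min_unique:
  assumes "clear_min \<Delta> \<eta> T e L" "clear_min \<Delta> \<eta> T' e L'" "L \<in> T'" "L' \<in> T" "\<eta> \<ge> 0"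
  shows "L = L'"
proof (rule ccontr)
  assume "L \<noteq> L'"
  then have "walk \<Delta> e L' - walk \<Delta> e L > \<eta> * (\<bar>L'\<bar> + \<bar>L\<bar>)"
    "walk \<Delta> e L - walk \<Delta> e L' > \<eta> * (\<bar>L\<bar> + \<bar>L'\<bar>)"
    using assms(1-4) by (auto simp: clear_min_def)
  moreover have "\<eta> * real_of_int (\<bar>L'\<bar> + \<bar>L\<bar>) \<ge> 0" "\<eta> * real_of_int (\<bar>L\<bar> + \<bar>L'\<bar>) \<ge> 0"
    using assms(5) by auto
  ultimately show False by linarith
qed

lemma clear_min_subset: "clear_min \<Delta> \<eta> T e L \<Longrightarrow> T' \<subseteq> T \<Longrightarrow> clear_min \<Delta> \<eta> T' e L"
  by (auto simp: clear_min_def)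

text \<open>A clear minimiser is strictly below every other site, so the selection by least modulus
  in \<open>walk_argmin\<close> has only one candidate.\<close>

lemma walk_argmin_clear_min:
  assumes "clear_min \<Delta> \<eta> UNIV e L" "\<eta> \<ge> 0"
  shows "walk_argmin \<Delta> e = L"
proof -
  have less: "walk \<Delta> e L < walk \<Delta> e k" if "k \<noteq> L" for k
  proof -
    have "walk \<Delta> e k - walk \<Delta> e L > \<eta> * (\<bar>k\<bar> + \<bar>L\<bar>)"
      using assms(1) that by (auto simp: clear_min_def)
    moreover have "\<eta> * real_of_int (\<bar>k\<bar> + \<bar>L\<bar>) \<ge> 0" using assms(2) by simp
    ultimately show ?thesis by linarith
  qed
  then have "is_arg_min (walk \<Delta> e) (\<lambda>_. True) = (\<lambda>k. k = L)"
    by (force simp: is_arg_min_def fun_eq_iff dest: less_asym)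
  moreover have "arg_min abs (\<lambda>k. k = L) = L"
    unfolding arg_min_def is_arg_min_def by (rule some_equality) auto
  ultimately show ?thesis
    by (simp add: walk_argmin_def)
qed

lemma abs_arg_min_abs_le_iff:
  fixes P :: "int \<Rightarrow> bool"
  assumes "P k" shows "\<bar>arg_min abs P\<bar> \<le> t \<longleftrightarrow> (\<exists>l. P l \<and> \<bar>l\<bar> \<le> t)"
proof -
  \<comment> \<open>Moduli are mapped to natural numbers, where a least element always
    exists.\<close>
  have eq: "arg_min abs P = arg_min (\<lambda>l. nat \<bar>l\<bar>) P"
  proof -
    have "nat \<bar>a\<bar> < nat \<bar>b\<bar> \<longleftrightarrow> \<bar>a\<bar> < \<bar>b\<bar>" for a b :: int by linarith
    then show ?thesis by (simp only: arg_min_def is_arg_min_def)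
  qed
  have "P (arg_min abs P)" "P l \<Longrightarrow> \<bar>arg_min abs P\<bar> \<le> \<bar>l\<bar>" for l
    unfolding eq using arg_min_nat_lemma[of P k "\<lambda>l. nat \<bar>l\<bar>"] assms
    by auto
  then show ?thesis by (meson order.trans)
qed

lemma sets_walk_argmin:
  "{e \<in> space (walk_noise \<sigma>1 \<sigma>2). \<bar>walk_argmin \<Delta> e\<bar> \<le> int t} \<in> sets (walk_noise \<sigma>1 \<sigma>2)"
proof -
  let ?W = "walk_noise \<sigma>1 \<sigma>2"
  let ?min = "\<lambda>e k. \<forall>l. walk \<Delta> e k \<le> walk \<Delta> e l"
  \<comment> \<open>The value of \<open>arg_min\<close> for an empty set of candidates, some fixed
    integer. On the event without any minimiser the condition is therefore constantly true or
    constantly false.\<close>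
  let ?c = "arg_min abs (\<lambda>_::int. False)"
  have min_sets: "{e \<in> space ?W. ?min e k} \<in> sets ?W" for k
    by (intro sets.sets_Collect_countable_All borel_measurable_le borel_measurable_walk)
  have iff: "\<bar>walk_argmin \<Delta> e\<bar> \<le> int t \<longleftrightarrow>
      (\<exists>k\<in>{- int t..int t}. ?min e k) \<or> ((\<forall>k. \<not> ?min e k) \<and> \<bar>?c\<bar> \<le> int t)" for e
  proof (cases "\<exists>k. ?min e k")
    case True
    then obtain k where "?min e k" by blast
    moreover have mins: "is_arg_min (walk \<Delta> e) (\<lambda>_. True) = ?min e"
      by (auto simp: is_arg_min_def fun_eq_iff not_less)
    ultimately show ?thesis
      using True abs_arg_min_abs_le_iff[of "?min e" k "int t"]
      unfolding walk_argmin_def mins by (auto simp: abs_le_iff)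
  next
    case False
    then have "is_arg_min (walk \<Delta> e) (\<lambda>_. True) = (\<lambda>_. False)"
      by (auto simp: is_arg_min_def fun_eq_iff not_less)
    then show ?thesis using False by (auto simp: walk_argmin_def)
  qed
  have "{e \<in> space ?W. \<forall>k. \<not> ?min e k} \<in> sets ?W"
    by (rule sets.sets_Collect_countable_All[OF sets.sets_Collect_neg[OF min_sets]])
  moreover have "{e \<in> space ?W. \<exists>k\<in>{- int t..int t}. ?min e k} \<in> sets ?W"
    by (rule sets.sets_Collect_countable_Bex[OF min_sets])
  ultimately show ?thesis unfolding iff
    by (intro sets.sets_Collect_disj sets.sets_Collect_conj sets.sets_Collect_const)
qed

lemma sets_clear_min:
  assumes "\<And>k. k \<in> insert L T \<Longrightarrow> (\<lambda>e. walk \<Delta> e k) \<in> borel_measurable N"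
  shows "{e \<in> space N. clear_min \<Delta> \<eta> T e L} \<in> sets N"
proof -
  have "{e \<in> space N. \<eta> * (\<bar>k\<bar> + \<bar>L\<bar>) < walk \<Delta> e k - walk \<Delta> e L} \<in> sets N" if "k \<in> T - {L}" for k
    using that assms by (intro borel_measurable_less borel_measurable_diff borel_measurable_const) blast+
  then have "{e \<in> space N. k \<in> T - {L} \<longrightarrow> \<eta> * (\<bar>k\<bar> + \<bar>L\<bar>) < walk \<Delta> e k - walk \<Delta> e L} \<in> sets N" for k
    by (cases "k \<in> T - {L}") (simp_all only: simp_thms Collect_mem_eq sets.top)
  then show ?thesis
    unfolding clear_min_def Ball_def by (rule sets.sets_Collect_countable_All)
qed

text \<open>A window that contains all sites within \<open>R\<close> and none beyond
  \<open>R'\<close> must have its minimiser at the certified \<open>L\<close>, whatever its exact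
  ends. With \<open>q = R\<close> this is the event that the minimiser is determined, with general
  \<open>q\<close> the coverage event.\<close>

definition decided :: "real \<Rightarrow> real \<Rightarrow> nat \<Rightarrow> nat \<Rightarrow> nat \<Rightarrow> (int \<Rightarrow> real) \<Rightarrow> bool" where
  "decided \<Delta> \<eta> R R' q e \<longleftrightarrow>
     (\<exists>L\<in>{- int (min R q)..int (min R q)}. clear_min \<Delta> \<eta> {- int R'..int R'} e L)"

lemma sets_decided:
  assumes "R \<le> R'" "\<And>k. \<bar>k\<bar> \<le> int R' \<Longrightarrow> (\<lambda>e. walk \<Delta> e k) \<in> borel_measurable N"
  shows "{e \<in> space N. decided \<Delta> \<eta> R R' q e} \<in> sets N"
  unfolding decided_def
proof (rule sets.sets_Collect_finite_Ex)
  fix L assume "L \<in> {- int (min R q)..int (min R q)}"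
  then have "\<bar>k\<bar> \<le> int R'" if "k \<in> insert L {- int R'..int R'}" for k
    using that assms(1) by (auto simp: abs_le_iff)
  then show "{e \<in> space N. clear_min \<Delta> \<eta> {- int R'..int R'} e L} \<in> sets N"
    by (intro sets_clear_min assms(2)) blast
qed simp

lemma (in finite_measure) abs_measure_diff_le:
  assumes "A \<subseteq> B \<union> C" "B \<subseteq> A \<union> C" "A \<in> sets M" "B \<in> sets M" "C \<in> sets M"
  shows "\<bar>measure M A - measure M B\<bar> \<le> measure M C"
proof -
  have "measure M A \<le> measure M B + measure M C" if "A \<subseteq> B \<union> C" "A \<in> sets M" "B \<in> sets M" for A B
    using finite_measure_mono[OF that(1)] measure_Un_le[of B M C] that assms(5) by auto
  from this[of A B] this[of B A] show ?thesis using assms by auto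
qed

context walk_bounds
begin

lemma unclear_sets: "{e \<in> space W. \<not> (\<exists>L. \<bar>L\<bar> \<le> int R \<and> clear_min \<Delta> \<eta> UNIV e L)} \<in> sets W"
  by (intro sets.sets_Collect_neg sets.sets_Collect_countable_Ex sets.sets_Collect_conj
      sets.sets_Collect_const sets_clear_min borel_measurable_walk)

lemma decided_sets: "R \<le> R' \<Longrightarrow> {e \<in> space W. decided \<Delta> \<eta> R R' q e} \<in> sets W"
  by (intro sets_decided borel_measurable_walk)

lemma undecided_prob:
  assumes "R \<le> R'" "0 \<le> \<eta>" "\<eta> \<le> D0 / 16"
  shows "W.prob {e \<in> space W. \<not> decided \<Delta> \<eta> R R' R e} \<le> unclear_const * (\<eta> + exp (- rate * real R))"
proof -
  have "{e \<in> space W. \<not> decided \<Delta> \<eta> R R' R e}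
      \<subseteq> {e \<in> space W. \<not> (\<exists>L. \<bar>L\<bar> \<le> int R \<and> clear_min \<Delta> \<eta> UNIV e L)}"
  proof (rule subsetI, rule ccontr)
    fix e assume e: "e \<in> {e \<in> space W. \<not> decided \<Delta> \<eta> R R' R e}"
      "e \<notin> {e \<in> space W. \<not> (\<exists>L. \<bar>L\<bar> \<le> int R \<and> clear_min \<Delta> \<eta> UNIV e L)}"
    then obtain L where L: "\<bar>L\<bar> \<le> int R" "clear_min \<Delta> \<eta> UNIV e L" by blast
    then have "clear_min \<Delta> \<eta> {- int R'..int R'} e L" "L \<in> {- int (min R R)..int (min R R)}"
      by (auto intro: clear_min_subset simp: abs_le_iff)
    then have "decided \<Delta> \<eta> R R' R e" unfolding decided_def by blast
    then show False using e(1) by simp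
  qed
  then have "W.prob {e \<in> space W. \<not> decided \<Delta> \<eta> R R' R e}
      \<le> W.prob {e \<in> space W. \<not> (\<exists>L. \<bar>L\<bar> \<le> int R \<and> clear_min \<Delta> \<eta> UNIV e L)}"
    by (intro W.finite_measure_mono unclear_sets)
  also have "\<dots> \<le> unclear_const * (\<eta> + exp (- rate * real R))"
    using assms by (intro clear_min_prob)
  finally show ?thesis .
qed

text \<open>Whenever a clear minimiser \<open>L\<close> over all integers exists within
  \<open>R\<close>, uniqueness forces every certificate on the finite range to name the same
  \<open>L\<close>, so the two events differ only where no such minimiser exists. The bound is
  uniform in \<open>q\<close>, which frees the choice of the quantile.\<close>

lemma decided_prob:
  assumes "R \<le> R'" "0 \<le> \<eta>" "\<eta> \<le> D0 / 16"
  shows "\<bar>W.prob {e \<in> space W. decided \<Delta> \<eta> R R' q e} - walk_cdf \<Delta> \<sigma>1 \<sigma>2 q\<bar>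
    \<le> unclear_const * (\<eta> + exp (- rate * real R))"
proof -
  let ?U = "{e \<in> space W. \<not> (\<exists>L. \<bar>L\<bar> \<le> int R \<and> clear_min \<Delta> \<eta> UNIV e L)}"
  have iff: "decided \<Delta> \<eta> R R' q e \<longleftrightarrow> \<bar>walk_argmin \<Delta> e\<bar> \<le> int q" if e: "e \<in> space W - ?U" for e
  proof -
    from e obtain L where L: "\<bar>L\<bar> \<le> int R" "clear_min \<Delta> \<eta> UNIV e L" by blast
    have "decided \<Delta> \<eta> R R' q e \<longleftrightarrow> \<bar>L\<bar> \<le> int q"
    proof
      assume "decided \<Delta> \<eta> R R' q e"
      then obtain L' where L': "L' \<in> {- int (min R q)..int (min R q)}" "clear_min \<Delta> \<eta> {- int R'..int R'} e L'"
        by (auto simp: decided_def)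
      have "L' = L"
        using L L' assms by (intro clear_min_unique[OF L'(2) L(2)]) auto
      then show "\<bar>L\<bar> \<le> int q" using L' by auto
    next
      assume "\<bar>L\<bar> \<le> int q"
      then have "L \<in> {- int (min R q)..int (min R q)}" using L by auto
      then show "decided \<Delta> \<eta> R R' q e"
        unfolding decided_def using clear_min_subset[OF L(2)] by blast
    qed
    then show ?thesis using walk_argmin_clear_min[OF L(2) assms(2)] by simp
  qed
  have "\<bar>W.prob {e \<in> space W. decided \<Delta> \<eta> R R' q e} - walk_cdf \<Delta> \<sigma>1 \<sigma>2 q\<bar> \<le> W.prob ?U"
    unfolding walk_cdf_def using iff
    by (intro W.abs_measure_diff_le unclear_sets decided_sets sets_walk_argmin assms) blast+
  also have "\<dots> \<le> unclear_const * (\<eta> + exp (- rate * real R))"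
    using assms by (intro clear_min_prob)
  finally show ?thesis .
qed

end

section \<open>Finite blocks of noise and their independence\<close>

lemma walk_restrict:
  assumes "\<bar>k\<bar> \<le> int R"
  shows "walk \<Delta> (restrict e {- int R + 1..int R}) k = walk \<Delta> e k"
  unfolding walk_eq_sum_steps using assms
  by (intro arg_cong2[where f = "(+)"] sum.cong) (auto simp: steps_def split: if_splits)

text \<open>The leftmost site \<open>- int R'\<close> uses increments from
  \<open>- int R' + 1\<close> on, hence a block of exactly \<open>2 * R'\<close>
  coordinates.\<close>

lemma decided_restrict:
  assumes "R \<le> R'"
  shows "decided \<Delta> \<eta> R R' q (restrict e {- int R' + 1..int R'}) \<longleftrightarrow> decided \<Delta> \<eta> R R' q e"
proof -
  have w: "walk \<Delta> (restrict e {- int R' + 1..int R'}) k = walk \<Delta> e k" if "k \<in> {- int R'..int R'}" for k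
    using that by (intro walk_restrict) auto
  have sub: "L \<in> {- int R'..int R'}" if "L \<in> {- int (min R q)..int (min R q)}" for L
    using that assms by auto
  show ?thesis
    unfolding decided_def clear_min_def
    by (intro bex_cong ball_cong refl) (simp only: w sub DiffD1)
qed

lemma borel_measurable_walk_PiM:
  assumes "\<bar>k\<bar> \<le> int R"
  shows "(\<lambda>e. walk \<Delta> e k) \<in> borel_measurable (\<Pi>\<^sub>M i\<in>{- int R + 1..int R}. borel)"
  unfolding walk_eq_sum_steps
proof (intro borel_measurable_add borel_measurable_const borel_measurable_sum)
  fix i assume "i \<in> steps k"
  then have "i \<in> {- int R + 1..int R}" using assms by (auto simp: steps_def split: if_splits)
  then show "(\<lambda>e. e i) \<in> borel_measurable (\<Pi>\<^sub>M i\<in>{- int R + 1..int R}. borel)"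
    by (rule measurable_component_singleton)
qed

lemma (in prob_space) indep_vars_reindex:
  assumes inj: "inj_on f I" and ind: "indep_vars (\<lambda>_. N) X (f ` I)"
  shows "indep_vars (\<lambda>_. N) (\<lambda>i. X (f i)) I"
  unfolding indep_vars_def
proof (intro conjI ballI)
  fix i assume "i \<in> I"
  then show "random_variable N (X (f i))" using ind by (auto simp: indep_vars_def)
next
  let ?F = "\<lambda>i. sigma_sets (space M) {X i -` A \<inter> space M |A. A \<in> sets N}"
  have F: "indep_sets ?F (f ` I)" using ind by (auto simp: indep_vars_def)
  show "indep_sets (\<lambda>i. ?F (f i)) I"
  proof (rule indep_setsI)
    fix i assume "i \<in> I"
    then show "?F (f i) \<subseteq> events" using F by (auto simp: indep_sets_def)
  next
    fix A J assume J: "J \<noteq> {}" "J \<subseteq> I" "finite J" and A: "\<forall>j\<in>J. A j \<in> ?F (f j)"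
    let ?g = "the_inv_into I f"
    have g: "?g (f j) = j" if "j \<in> J" for j using that J inj by (auto intro: the_inv_into_f_f)
    have inj': "inj_on f J" using inj J(2) by (rule inj_on_subset)
    have "prob (\<Inter>k\<in>f ` J. A (?g k)) = (\<Prod>k\<in>f ` J. prob (A (?g k)))"
      using J A g by (intro indep_setsD[OF F]) auto
    then show "prob (\<Inter>j\<in>J. A j) = (\<Prod>j\<in>J. prob (A j))"
      using g by (simp add: prod.reindex[OF inj'] cong: INF_cong prod.cong)
  qed
qed

text \<open>Blocks with different first index are independent, and each has the law of a finite
  marginal of the walk noise. Joint probabilities in one sample thus become products of
  probabilities for separate walks.\<close>

lemma (in prob_space) prob_gaussian_blocks:
  fixes Z :: "'j \<times> int \<Rightarrow> 'a \<Rightarrow> real"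
  assumes fin: "finite A" "A \<noteq> {}" "finite I" "I \<noteq> {}"
    and indep: "indep_vars (\<lambda>_. borel) Z (A \<times> I)"
    and dist: "\<And>j t. j \<in> A \<Longrightarrow> t \<in> I \<Longrightarrow>
      distributed M lborel (Z (j, t)) (normal_density 0 (if t \<le> 0 then s j else s' j))"
    and s: "\<And>j. s j > 0" "\<And>j. s' j > 0"
    and P: "\<And>j e. j \<in> A \<Longrightarrow> P j (restrict e I) \<longleftrightarrow> P j e"
    and meas: "\<And>j. j \<in> A \<Longrightarrow> {x \<in> space (\<Pi>\<^sub>M i\<in>I. borel). P j x} \<in> sets (\<Pi>\<^sub>M i\<in>I. borel)"
  shows "{\<omega> \<in> space M. \<forall>j\<in>A. P j (\<lambda>t. Z (j, t) \<omega>)} \<in> sets M" (is ?th1)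
    and "prob {\<omega> \<in> space M. \<forall>j\<in>A. P j (\<lambda>t. Z (j, t) \<omega>)}
    = (\<Prod>j\<in>A. measure (walk_noise (s j) (s' j)) {e \<in> space (walk_noise (s j) (s' j)). P j e})" (is ?th2)
proof -
  let ?B = "\<Pi>\<^sub>M t\<in>I. (borel :: real measure)"
  let ?X = "\<lambda>j \<omega>. \<lambda>t\<in>I. Z (j, t) \<omega>"
  have Z: "random_variable borel (Z (j, t))" if "j \<in> A" "t \<in> I" for j t
    using indep that by (auto simp: indep_vars_def)
  have X [measurable]: "random_variable ?B (?X j)" if "j \<in> A" for j
    using Z that by (intro measurable_restrict)
  have ev: "{\<omega> \<in> space M. P j (\<lambda>t. Z (j, t) \<omega>)} = ?X j -` {x \<in> space ?B. P j x} \<inter> space M" if "j \<in> A" for j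
    using P[OF that] measurable_space[OF X[OF that]] by auto
  have inter: "{\<omega> \<in> space M. \<forall>j\<in>A. P j (\<lambda>t. Z (j, t) \<omega>)} = (\<Inter>j\<in>A. ?X j -` {x \<in> space ?B. P j x} \<inter> space M)"
    using fin(2) ev by blast
  show ?th1
    unfolding inter using measurable_sets[OF X meas] fin by (intro sets.finite_INT) blast+
  \<comment> \<open>The restrictions to the disjoint sets \<open>{j} \<times> I\<close> are
    independent; the constant first index is dropped next, so that all blocks take values in one
    space.\<close>
  have "indep_vars (\<lambda>j. \<Pi>\<^sub>M p\<in>{j} \<times> I. borel) (\<lambda>j \<omega>. \<lambda>p\<in>{j} \<times> I. Z p \<omega>) A"
    by (intro indep_vars_restrict[OF indep]) (auto simp: disjoint_family_on_def)
  then have "indep_vars (\<lambda>_. ?B) (\<lambda>j \<omega>. (\<lambda>x. \<lambda>t\<in>I. x (j, t)) (\<lambda>p\<in>{j} \<times> I. Z p \<omega>)) A"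
    by (rule indep_vars_compose2)
       (intro measurable_restrict measurable_component_singleton, auto)
  then have "indep_vars (\<lambda>_. ?B) ?X A"
    by (rule back_subst[of "\<lambda>X. indep_vars (\<lambda>_. ?B) X A"]) (auto simp: restrict_def fun_eq_iff)
  then have "prob {\<omega> \<in> space M. \<forall>j\<in>A. P j (\<lambda>t. Z (j, t) \<omega>)}
    = (\<Prod>j\<in>A. prob (?X j -` {x \<in> space ?B. P j x} \<inter> space M))"
    unfolding inter using fin meas by (intro indep_varsD_finite) auto
  also have "\<dots> = (\<Prod>j\<in>A. measure (walk_noise (s j) (s' j)) {e \<in> space (walk_noise (s j) (s' j)). P j e})"
  proof (intro prod.cong refl)
    fix j assume j: "j \<in> A"
    let ?G = "\<Pi>\<^sub>M t\<in>I. gaussian (if t \<le> 0 then s j else s' j)"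
    have sets: "sets ?G = sets ?B" by (intro sets_PiM_cong) auto
    have "indep_vars (\<lambda>_. borel) Z (Pair j ` I)"
      using indep j by (rule_tac indep_vars_subset[OF indep]) auto
    then have "indep_vars (\<lambda>_. borel) (\<lambda>t. Z (j, t)) I"
      by (rule indep_vars_reindex[rotated]) (simp add: inj_on_def)
    then have "distr M ?B (?X j) = (\<Pi>\<^sub>M t\<in>I. distr M borel (Z (j, t)))"
      using indep_vars_iff_distr_eq_PiM'[OF fin(4), where M' = "\<lambda>_. borel" and X = "\<lambda>t. Z (j, t)"] Z[OF j] by simp
    also have "\<dots> = ?G"
    proof (intro PiM_cong refl)
      fix t assume t: "t \<in> I"
      have "distr M borel (Z (j, t)) = distr M lborel (Z (j, t))" by (intro distr_cong) auto
      then show "distr M borel (Z (j, t)) = gaussian (if t \<le> 0 then s j else s' j)"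
        using distributed_distr_eq_density[OF dist[OF j t]] by simp
    qed
    finally have distr: "distr M ?B (?X j) = ?G" .
    have "emeasure M (?X j -` {x \<in> space ?B. P j x} \<inter> space M) = emeasure ?G {x \<in> space ?B. P j x}"
      unfolding distr[symmetric] using X[OF j] meas[OF j] by (simp add: emeasure_distr)
    also have "\<dots> = emeasure (walk_noise (s j) (s' j)) {e \<in> space (walk_noise (s j) (s' j)). P j e}"
      unfolding sets_eq_imp_space_eq[OF sets, symmetric]
      by (rule emeasure_walk_noise_cylinder[symmetric]) (use fin s P[OF j] meas[OF j] in auto)
    finally show "prob (?X j -` {x \<in> space ?B. P j x} \<inter> space M)
      = measure (walk_noise (s j) (s' j)) {e \<in> space (walk_noise (s j) (s' j)). P j e}"
      by (simp add: measure_def)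
  qed
  finally show ?th2 .
qed

subsection \<open>The least squares criterion as a random walk\<close>

text \<open>The time of the walk is measured in ranks, since the criterion skips grid points. The
  argument \<open>d\<close> may lie outside \<open>G\<close>: a change point can itself be a grid
  point.\<close>

definition rank_in :: "nat set \<Rightarrow> nat \<Rightarrow> nat" where
  "rank_in G d = card {i \<in> G. i \<le> d}"

definition of_rank :: "nat set \<Rightarrow> nat \<Rightarrow> nat" where
  "of_rank G = the_inv_into G (rank_in G)"

lemma rank_mono: "finite G \<Longrightarrow> x \<le> y \<Longrightarrow> rank_in G x \<le> rank_in G y"
  unfolding rank_in_def by (intro card_mono) auto

lemma rank_diff:
  assumes "finite G" "x \<le> y"
  shows "rank_in G y - rank_in G x = card {i \<in> G. x < i \<and> i \<le> y}"
    and "int (rank_in G y) - int (rank_in G x) = int (card {i \<in> G. x < i \<and> i \<le> y})"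
proof -
  have "{i \<in> G. i \<le> y} = {i \<in> G. i \<le> x} \<union> {i \<in> G. x < i \<and> i \<le> y}" using assms by auto
  then have "rank_in G y = rank_in G x + card {i \<in> G. x < i \<and> i \<le> y}"
    unfolding rank_in_def using assms(1) by (subst card_Un_disjoint[symmetric]) auto
  then show "rank_in G y - rank_in G x = card {i \<in> G. x < i \<and> i \<le> y}"
    "int (rank_in G y) - int (rank_in G x) = int (card {i \<in> G. x < i \<and> i \<le> y})" by simp_all
qed

lemma rank_le_iff:
  assumes "finite G" "i \<in> G"
  shows "rank_in G i \<le> rank_in G d \<longleftrightarrow> i \<le> d"
proof
  show "i \<le> d" if "rank_in G i \<le> rank_in G d"
  proof (rule ccontr)
    assume "\<not> i \<le> d"
    then have "{j \<in> G. j \<le> d} \<subset> {j \<in> G. j \<le> i}" using assms(2) by auto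
    then have "rank_in G d < rank_in G i" unfolding rank_in_def using assms(1) by (intro psubset_card_mono) auto
    then show False using that by simp
  qed
qed (rule rank_mono[OF assms(1)])

lemma inj_on_rank: "finite G \<Longrightarrow> inj_on (rank_in G) G"
  by (rule inj_onI) (metis rank_le_iff order_antisym order_refl)

lemma bij_betw_rank:
  assumes "finite G" shows "bij_betw (rank_in G) G {1..card G}"
proof -
  have "rank_in G ` G \<subseteq> {1..card G}"
  proof (rule image_subsetI)
    fix i assume i: "i \<in> G"
    have "rank_in G i \<le> card G" unfolding rank_in_def using assms by (intro card_mono) auto
    moreover have "rank_in G i > 0" unfolding rank_in_def using assms i by (subst card_gt_0_iff) auto
    ultimately show "rank_in G i \<in> {1..card G}" by simp
  qed
  moreover have "card (rank_in G ` G) = card G" by (rule card_image[OF inj_on_rank[OF assms]])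
  ultimately have "rank_in G ` G = {1..card G}" by (intro card_subset_eq) auto
  then show ?thesis using inj_on_rank[OF assms] by (simp add: bij_betw_def)
qed

lemma of_rank:
  assumes "finite G" "u \<in> {1..card G}"
  shows "of_rank G u \<in> G" "rank_in G (of_rank G u) = u"
proof -
  have img: "rank_in G ` G = {1..card G}" using bij_betw_rank[OF assms(1)] by (simp add: bij_betw_def)
  show "of_rank G u \<in> G"
    unfolding of_rank_def using assms(2) img
    by (intro the_inv_into_into[OF inj_on_rank[OF assms(1)]]) auto
  show "rank_in G (of_rank G u) = u"
    unfolding of_rank_def using assms(2) img
    by (intro f_the_inv_into_f[OF inj_on_rank[OF assms(1)]]) auto
qed

lemma of_rank_rank: "finite G \<Longrightarrow> i \<in> G \<Longrightarrow> of_rank G (rank_in G i) = i"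
  unfolding of_rank_def by (rule the_inv_into_f_f[OF inj_on_rank])

text \<open>Moving the split to the right of \<open>c\<close> adds terms and moving it to the left
  removes them, hence the sign \<open>- 1\<close> at offsets \<open>u \<le> 0\<close>.\<close>

lemma sum_rank_steps:
  fixes g :: "nat \<Rightarrow> real" and c :: nat
  assumes G: "finite G" and d: "d \<in> G"
  defines "t \<equiv> int (rank_in G d) - int (rank_in G c)"
  shows "(\<Sum>i\<in>{i \<in> G. i \<le> d}. g i) - (\<Sum>i\<in>{i \<in> G. i \<le> c}. g i)
    = (\<Sum>u\<in>steps t. (if u \<le> 0 then - 1 else 1) * g (of_rank G (nat (int (rank_in G c) + u))))"
proof -
  let ?pos = "\<lambda>u. of_rank G (nat (int (rank_in G c) + u))"
  have shift: "(\<Sum>i\<in>{i \<in> G. x < i \<and> i \<le> y}. g i)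
      = (\<Sum>u\<in>{int (rank_in G x) - int (rank_in G c) + 1..int (rank_in G y) - int (rank_in G c)}. g (?pos u))"
      (is "_ = sum _ ?U") if "x \<le> y" for x y
  proof (rule sum.reindex_bij_witness[of _ ?pos "\<lambda>i. int (rank_in G i) - int (rank_in G c)"])
    fix i assume i: "i \<in> {i \<in> G. x < i \<and> i \<le> y}"
    then show "?pos (int (rank_in G i) - int (rank_in G c)) = i" using of_rank_rank[OF G] by simp
    have "rank_in G i \<le> rank_in G y" "\<not> rank_in G i \<le> rank_in G x" using i G by (auto simp: rank_le_iff rank_mono)
    then show "int (rank_in G i) - int (rank_in G c) \<in> ?U" by auto
    show "g (?pos (int (rank_in G i) - int (rank_in G c))) = g i" using i of_rank_rank[OF G] by simp
  next
    fix u assume u: "u \<in> ?U"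
    have "rank_in G y \<le> card G" unfolding rank_in_def using G by (intro card_mono) auto
    then have "nat (int (rank_in G c) + u) \<in> {1..card G}" using u by auto
    note pos = of_rank[OF G this]
    then show "int (rank_in G (?pos u)) - int (rank_in G c) = u" using u by auto
    have "rank_in G (?pos u) \<le> rank_in G y" "\<not> rank_in G (?pos u) \<le> rank_in G x" using u pos by auto
    then show "?pos u \<in> {i \<in> G. x < i \<and> i \<le> y}" using pos(1) by (simp add: rank_le_iff[OF G])
  qed
  have split: "(\<Sum>i\<in>{i \<in> G. i \<le> y}. g i) - (\<Sum>i\<in>{i \<in> G. i \<le> x}. g i) = (\<Sum>i\<in>{i \<in> G. x < i \<and> i \<le> y}. g i)"
    if "x \<le> y" for x y
  proof -
    have "{i \<in> G. i \<le> y} = {i \<in> G. i \<le> x} \<union> {i \<in> G. x < i \<and> i \<le> y}" using that by auto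
    then have "(\<Sum>i\<in>{i \<in> G. i \<le> y}. g i) = (\<Sum>i\<in>{i \<in> G. i \<le> x}. g i) + (\<Sum>i\<in>{i \<in> G. x < i \<and> i \<le> y}. g i)"
      using G by (simp only:) (intro sum.union_disjoint, auto)
    then show ?thesis by simp
  qed
  show ?thesis
  proof (cases "c < d")
    case True
    then have "t > 0" unfolding t_def using rank_le_iff[OF G d, of c] by auto
    then show ?thesis using split[of c d] shift[of c d] True
      by (simp add: steps_def t_def)
  next
    case False
    then have t: "t \<le> 0" unfolding t_def using rank_mono[OF G, of d c] by auto
    have "(\<Sum>i\<in>{i \<in> G. i \<le> d}. g i) - (\<Sum>i\<in>{i \<in> G. i \<le> c}. g i) = - (\<Sum>i\<in>{i \<in> G. d < i \<and> i \<le> c}. g i)"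
      using split[of d c] False by simp
    also have "\<dots> = - (\<Sum>u\<in>steps t. g (?pos u))"
      using shift[of d c] False t by (simp add: steps_def t_def)
    also have "\<dots> = (\<Sum>u\<in>steps t. (if u \<le> 0 then - 1 else 1) * g (?pos u))"
      unfolding sum_negf[symmetric] using t by (intro sum.cong) (auto simp: steps_def)
    finally show ?thesis .
  qed
qed

text \<open>The window is an interval of \<open>G\<close>, so the part of \<open>G\<close> below it
  adds the same amount for every split. The sum may then start at the bottom of \<open>G\<close>,
  and the window survives only in the constant.\<close>

lemma split_objective:
  fixes y :: "nat \<Rightarrow> real"
  assumes G: "finite G" and S: "S = {d \<in> G. lo \<le> real d \<and> real d \<le> hi}"
  obtains C where "\<And>d. d \<in> S \<Longrightarrow>
    (\<Sum>j\<in>S. (y j - a * of_bool (j \<le> d) - b * of_bool (j > d))\<^sup>2)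
      = C + (\<Sum>j\<in>{j \<in> G. j \<le> d}. (y j - a)\<^sup>2 - (y j - b)\<^sup>2)"
proof -
  let ?g = "\<lambda>j. (y j - a)\<^sup>2 - (y j - b)\<^sup>2"
  let ?below = "{j \<in> G. real j < lo}"
  have finS: "finite S" using G S by simp
  have "(\<Sum>j\<in>S. (y j - a * of_bool (j \<le> d) - b * of_bool (j > d))\<^sup>2)
      = ((\<Sum>j\<in>S. (y j - b)\<^sup>2) - (\<Sum>j\<in>?below. ?g j)) + (\<Sum>j\<in>{j \<in> G. j \<le> d}. ?g j)" if d: "d \<in> S" for d
  proof -
    have "(\<Sum>j\<in>S. (y j - a * of_bool (j \<le> d) - b * of_bool (j > d))\<^sup>2)
      = (\<Sum>j\<in>S. (y j - b)\<^sup>2 + (if j \<le> d then ?g j else 0))"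
      by (intro sum.cong) auto
    also have "\<dots> = (\<Sum>j\<in>S. (y j - b)\<^sup>2) + (\<Sum>j\<in>{j \<in> S. j \<le> d}. ?g j)"
      by (simp only: sum.distrib sum.inter_filter[OF finS])
    also have "(\<Sum>j\<in>{j \<in> G. j \<le> d}. ?g j) = (\<Sum>j\<in>{j \<in> S. j \<le> d}. ?g j) + (\<Sum>j\<in>?below. ?g j)"
    proof -
      have "{j \<in> G. j \<le> d} = {j \<in> S. j \<le> d} \<union> ?below" using d S by auto
      moreover have "{j \<in> S. j \<le> d} \<inter> ?below = {}" using S by auto
      ultimately show ?thesis using G finS by (simp add: sum.union_disjoint)
    qed
    ultimately show ?thesis by simp
  qed
  then show thesis by (rule that)
qed

text \<open>The margin \<open>\<eta> * (\<bar>k\<bar> + \<bar>L\<bar>)\<close> is exactly the sum of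
  the approximation errors at \<open>k\<close> and \<open>L\<close>, and its strictness leaves
  \<open>arg_min_on\<close> no choice. Normalising by \<open>C\<close> and \<open>\<kappa>\<close>
  does not move minimisers.\<close>

lemma arg_min_on_clear_min:
  fixes F :: "nat \<Rightarrow> real" and t :: "nat \<Rightarrow> int"
  assumes clear: "clear_min \<Delta> \<eta> T e L"
    and T: "\<And>d. d \<in> S \<Longrightarrow> t d \<in> T" and inj: "inj_on t S"
    and m: "m \<in> S" "t m = L"
    and F: "\<kappa> > 0" "\<And>d. d \<in> S \<Longrightarrow> \<bar>(F d - C) / \<kappa> - walk \<Delta> e (t d)\<bar> \<le> \<eta> * \<bar>t d\<bar>"
  shows "arg_min_on F S = m"
proof -
  have less: "F m < F d" if d: "d \<in> S" "d \<noteq> m" for d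
  proof -
    have "t d \<noteq> L" using inj d m by (auto simp: inj_on_def)
    then have "walk \<Delta> e (t d) - walk \<Delta> e L > \<eta> * (\<bar>t d\<bar> + \<bar>L\<bar>)"
      using clear T[OF d(1)] by (auto simp: clear_min_def)
    moreover have "\<bar>(F d - C) / \<kappa> - walk \<Delta> e (t d)\<bar> \<le> \<eta> * \<bar>t d\<bar>"
      "\<bar>(F m - C) / \<kappa> - walk \<Delta> e L\<bar> \<le> \<eta> * \<bar>L\<bar>"
      using F(2)[OF d(1)] F(2)[OF m(1)] m(2) by auto
    ultimately have "(F m - C) / \<kappa> < (F d - C) / \<kappa>" by (simp add: distrib_left abs_le_iff)
    then show ?thesis using F(1) by (simp add: divide_less_cancel)
  qed
  have "is_arg_min F (\<lambda>d. d \<in> S) x \<longleftrightarrow> x = m" for x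
    using less m by (force simp: is_arg_min_def)
  then show ?thesis unfolding arg_min_on_def arg_min_def by (intro some_equality) auto
qed

text \<open>Entirely deterministic. After normalisation the criterion is a walk with noise
  \<open>e\<close> and drift \<open>h\<close>; the fitted levels \<open>a\<close> and
  \<open>b\<close> influence \<open>h\<close> but not \<open>e\<close>, and each step of
  \<open>h\<close> is within \<open>2 * \<rho>\<close> of \<open>\<Delta> / 2\<close>.\<close>

lemma split_argmin_rank:
  fixes y \<epsilon> :: "nat \<Rightarrow> real"
  assumes G: "finite G" and S: "S = {d \<in> G. lo \<le> real d \<and> real d \<le> hi}"
    and near: "\<And>d. d \<in> S \<Longrightarrow> \<bar>int (rank_in G d) - int (rank_in G c)\<bar> \<le> int R'"
    and far: "\<And>d. d \<in> G \<Longrightarrow> \<bar>int (rank_in G d) - int (rank_in G c)\<bar> \<le> int R \<Longrightarrow> d \<in> S"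
    and "R \<le> R'" and c: "int R' \<le> int (rank_in G c)" "int (rank_in G c) + int R' \<le> int (card G)"
    and y: "\<And>u. u \<in> {- int R' + 1..int R'} \<Longrightarrow>
      y (of_rank G (nat (int (rank_in G c) + u))) = (if u \<le> 0 then \<mu> else \<mu>') + \<epsilon> (of_rank G (nat (int (rank_in G c) + u)))"
    and ab: "\<bar>a - \<mu>\<bar> \<le> \<rho>" "\<bar>b - \<mu>'\<bar> \<le> \<rho>" and sep: "\<bar>\<mu>' - \<mu>\<bar> > 2 * \<rho>"
    and \<Delta>: "\<bar>\<Delta> - \<bar>\<mu>' - \<mu>\<bar>\<bar> \<le> 2 * \<rho>"
  defines "e \<equiv> \<lambda>u. (if u \<le> 0 then - sgn (\<mu>' - \<mu>) else sgn (\<mu>' - \<mu>)) * \<epsilon> (of_rank G (nat (int (rank_in G c) + u)))"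
  assumes clear: "clear_min \<Delta> (2 * \<rho>) {- int R'..int R'} e L" and L: "\<bar>L\<bar> \<le> int R"
    and L0: "int (rank_in G c) + L \<ge> 1"
  shows "int (rank_in G (split_argmin S y a b)) - int (rank_in G c) = L"
proof -
  let ?t = "\<lambda>d. int (rank_in G d) - int (rank_in G c)" and ?pos = "\<lambda>u. of_rank G (nat (int (rank_in G c) + u))"
  let ?g = "\<lambda>j. (y j - a)\<^sup>2 - (y j - b)\<^sup>2"
  let ?F = "\<lambda>d. \<Sum>j\<in>S. (y j - a * of_bool (j \<le> d) - b * of_bool (j > d))\<^sup>2"
  define s where "s = sgn (\<mu>' - \<mu>)"
  \<comment> \<open>From \<open>(y - a)\<^sup>2 - (y - b)\<^sup>2 = 2 * (b - a) * (y - (a + b) /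
    2)\<close>: division by \<open>2 * \<bar>b - a\<bar>\<close> leaves a signed distance to the
    midpoint.\<close>
  define \<kappa> where "\<kappa> = 2 * \<bar>b - a\<bar>"
  have s: "s = 1 \<and> \<mu>' - \<mu> > 2 * \<rho> \<or> s = - 1 \<and> \<mu> - \<mu>' > 2 * \<rho>"
    using sep ab by (auto simp: s_def sgn_if abs_if split: if_splits)
  \<comment> \<open>As the jump exceeds \<open>2 * \<rho>\<close>, the fitted jump
    \<open>b - a\<close> is nonzero and has the sign of the true one.\<close>
  have \<kappa>: "\<kappa> > 0" "b - a = s * (\<kappa> / 2)"
    using s ab by (auto simp: \<kappa>_def)
  obtain C0 where C0: "\<And>d. d \<in> S \<Longrightarrow> ?F d = C0 + (\<Sum>j\<in>{j \<in> G. j \<le> d}. ?g j)"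
    using split_objective[OF G S] by blast
  define C where "C = C0 + (\<Sum>j\<in>{j \<in> G. j \<le> c}. ?g j)"
  define h where "h = (\<lambda>u::int. if u \<le> 0 then s * ((a + b) / 2 - \<mu>) else s * (\<mu>' - (a + b) / 2))"
  \<comment> \<open>The midpoint is off by at most \<open>\<rho>\<close>, and
    \<open>\<Delta> / 2\<close> differs from half the true jump by at most
    \<open>\<rho>\<close>.\<close>
  have h: "\<bar>h u - \<Delta> / 2\<bar> \<le> 2 * \<rho>" for u
  proof -
    have ab': "\<mu> - \<rho> \<le> a" "a \<le> \<mu> + \<rho>" "\<mu>' - \<rho> \<le> b" "b \<le> \<mu>' + \<rho>"
      using ab by linarith+
    have \<Delta>': "\<bar>\<Delta> - s * (\<mu>' - \<mu>)\<bar> \<le> 2 * \<rho>"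
      using \<Delta> by (simp add: s_def abs_sgn mult.commute)
    consider "s = 1" "\<mu>' - \<mu> > 2 * \<rho>" | "s = - 1" "\<mu> - \<mu>' > 2 * \<rho>" using s by blast
    then show ?thesis
    proof cases
      case 1
      have hu: "h u = (if u \<le> 0 then (a + b) / 2 - \<mu> else \<mu>' - (a + b) / 2)" by (simp add: h_def 1)
      have "\<bar>\<Delta> - (\<mu>' - \<mu>)\<bar> \<le> 2 * \<rho>" using \<Delta>' 1(1) by simp
      then show ?thesis using ab' unfolding hu
        by (cases "u \<le> 0"; simp only: if_True if_False add_divide_distrib; linarith)
    next
      case 2
      have hu: "h u = (if u \<le> 0 then \<mu> - (a + b) / 2 else (a + b) / 2 - \<mu>')" by (simp add: h_def 2)
      have "\<bar>\<Delta> - (\<mu> - \<mu>')\<bar> \<le> 2 * \<rho>" using \<Delta>' 2(1) by simp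
      then show ?thesis using ab' unfolding hu
        by (cases "u \<le> 0"; simp only: if_True if_False add_divide_distrib; linarith)
    qed
  qed
  have F: "\<bar>(?F d - C) / \<kappa> - walk \<Delta> e (?t d)\<bar> \<le> 2 * \<rho> * \<bar>?t d\<bar>" if d: "d \<in> S" for d
  proof -
    have dG: "d \<in> G" using d S by simp
    have st: "steps (?t d) \<subseteq> {- int R' + 1..int R'}"
      using near[OF d] by (auto simp: steps_def split: if_splits)
    have "?F d - C = (\<Sum>u\<in>steps (?t d). (if u \<le> 0 then - 1 else 1) * ?g (?pos u))"
      using C0[OF d] sum_rank_steps[OF G dG, of ?g c] unfolding C_def by linarith
    also have "\<dots> = (\<Sum>u\<in>steps (?t d). \<kappa> * (e u + h u))"
    proof (intro sum.cong refl)
      fix u assume "u \<in> steps (?t d)"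
      then have yu: "y (?pos u) = (if u \<le> 0 then \<mu> else \<mu>') + \<epsilon> (?pos u)" using st y by blast
      have "?g (?pos u) = (b - a) * (2 * y (?pos u) - (a + b))"
        by (simp add: power2_eq_square algebra_simps)
      also have "\<dots> = s * \<kappa> * (y (?pos u) - (a + b) / 2)" unfolding \<kappa>(2) by (simp add: algebra_simps)
      finally show "(if u \<le> 0 then - 1 else 1) * ?g (?pos u) = \<kappa> * (e u + h u)"
        unfolding yu by (simp add: e_def h_def flip: s_def) (simp add: algebra_simps)
    qed
    also have "\<dots> = \<kappa> * (\<Sum>u\<in>steps (?t d). e u + h u)" by (simp add: sum_distrib_left)
    finally have "(?F d - C) / \<kappa> = (\<Sum>u\<in>steps (?t d). e u + h u)" using \<kappa>(1) by simp
    then have "(?F d - C) / \<kappa> - walk \<Delta> e (?t d) = (\<Sum>u\<in>steps (?t d). h u - \<Delta> / 2)"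
      by (simp add: walk_eq_sum_steps sum.distrib sum_subtractf)
    also have "\<bar>\<dots>\<bar> \<le> (\<Sum>u\<in>steps (?t d). 2 * \<rho>)"
      by (intro order.trans[OF sum_abs] sum_mono h)
    also have "\<dots> = 2 * \<rho> * \<bar>?t d\<bar>" by simp
    finally show ?thesis .
  qed
  define m where "m = ?pos L"
  \<comment> \<open>\<open>L0\<close> excludes rank 0, which no element of \<open>G\<close>
    has.\<close>
  have "nat (int (rank_in G c) + L) \<in> {1..card G}" using L L0 \<open>R \<le> R'\<close> c by auto
  note m = of_rank[OF G this, folded m_def]
  have tm: "?t m = L" using m(2) L0 by auto
  have mS: "m \<in> S" using far[OF m(1)] tm L by simp
  have "inj_on ?t S"
    using inj_on_rank[OF G] S by (auto simp: inj_on_def)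
  moreover have "?t d \<in> {- int R'..int R'}" if "d \<in> S" for d
    using near[OF that] by auto
  ultimately have "arg_min_on ?F S = m"
    using clear tm mS \<kappa>(1) F
    by (intro arg_min_on_clear_min[where t = ?t and L = L and C = C and \<kappa> = \<kappa>])
  then show ?thesis using tm by (simp add: split_argmin_def)
qed

section \<open>Counting off-grid indices\<close>

definition off_grid :: "real \<Rightarrow> real \<Rightarrow> nat \<Rightarrow> nat set" where
  "off_grid K1 \<gamma> N = {i \<in> {1..N}. \<not> skip K1 \<gamma> N dvd i}"

lemma finite_off_grid [simp]: "finite (off_grid K1 \<gamma> N)"
  by (simp add: off_grid_def)

lemma lambda2_eq_rank:
  "lambda2 K1 \<gamma> N a b = int (rank_in (off_grid K1 \<gamma> N) b) - int (rank_in (off_grid K1 \<gamma> N) a)"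
proof -
  have *: "{i \<in> {1..N}. x < i \<and> i \<le> y \<and> \<not> skip K1 \<gamma> N dvd i} = {i \<in> off_grid K1 \<gamma> N. x < i \<and> i \<le> y}" for x y
    by (auto simp: off_grid_def)
  show ?thesis
    using rank_diff(2)[of "off_grid K1 \<gamma> N" a b] rank_diff(2)[of "off_grid K1 \<gamma> N" b a]
    unfolding lambda2_def * by auto
qed

text \<open>As the spacing is at least 2, the predecessor of a multiple is not a multiple. It is
  thus one of the counted off-grid indices or equal to \<open>x\<close>; the latter accounts for the
  \<open>+ 1\<close>.\<close>

lemma rank_off_grid_diff:
  assumes "x \<le> y" "y \<le> N" "skip K1 \<gamma> N \<ge> 2"
  shows "rank_in (off_grid K1 \<gamma> N) y - rank_in (off_grid K1 \<gamma> N) x \<le> y - x"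
    and "y - x \<le> 2 * (rank_in (off_grid K1 \<gamma> N) y - rank_in (off_grid K1 \<gamma> N) x) + 1"
proof -
  let ?p = "skip K1 \<gamma> N" and ?G = "off_grid K1 \<gamma> N"
  let ?A = "{i \<in> ?G. x < i \<and> i \<le> y}" and ?B = "{i \<in> {x<..y}. ?p dvd i}"
  have A: "?A = {i \<in> {x<..y}. \<not> ?p dvd i}" using assms by (auto simp: off_grid_def)
  have "?A \<subseteq> {x<..y}" by auto
  then have "card ?A \<le> y - x" by (metis card_greaterThanAtMost card_mono finite_greaterThanAtMost)
  then show "rank_in ?G y - rank_in ?G x \<le> y - x" using rank_diff(1)[of ?G x y] assms(1) by simp
  have "(\<lambda>i. i - 1) ` ?B \<subseteq> insert x ?A"
  proof (rule image_subsetI)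
    fix i assume i: "i \<in> ?B"
    have "\<not> ?p dvd i - 1"
    proof
      assume "?p dvd i - 1"
      then have "?p dvd i - (i - 1)" using i by (blast intro: dvd_diff_nat)
      moreover have "i - (i - 1) = 1" using i by auto
      ultimately have "?p dvd 1" by metis
      then show False using assms(3) by simp
    qed
    then show "i - 1 \<in> insert x ?A" unfolding A using i by auto
  qed
  then have "card ((\<lambda>i. i - 1) ` ?B) \<le> card (insert x ?A)" by (intro card_mono) auto
  moreover have "inj_on (\<lambda>i. i - 1) ?B" by (auto simp: inj_on_def)
  ultimately have "card ?B \<le> Suc (card ?A)" using card_insert_le_m1 by (simp add: card_image card_insert_if split: if_splits)
  moreover have "card ?A + card ?B = y - x"
  proof -
    have "card (?A \<union> ?B) = card ?A + card ?B" by (rule card_Un_disjoint) (auto simp: A)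
    moreover have "?A \<union> ?B = {x<..y}" unfolding A by auto
    ultimately show ?thesis by simp
  qed
  ultimately show "y - x \<le> 2 * (rank_in ?G y - rank_in ?G x) + 1"
    using rank_diff(1)[of ?G x y] assms(1) by simp
qed

subsection \<open>The coverage error at a fixed sample size\<close>

text \<open>The minimiser is a Hilbert choice, but it depends on the data only through the finite set of
  minimisers, so ties cannot destroy measurability.\<close>

lemma measurable_split_argmin:
  assumes x: "x \<in> borel_measurable M"
    and a: "a \<in> borel_measurable M" and b: "b \<in> borel_measurable M"
    and Y: "\<And>i. i \<in> {1..N} \<Longrightarrow> Y i \<in> borel_measurable M"
  shows "(\<lambda>\<omega>. split_argmin (window K1 \<gamma> N r (x \<omega>)) (\<lambda>j. Y j \<omega>) (a \<omega>) (b \<omega>)) \<in> measurable M (count_space UNIV)"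
proof -
  let ?S = "\<lambda>\<omega>. window K1 \<gamma> N r (x \<omega>)"
  let ?t = "\<lambda>\<omega> d j. (Y j \<omega> - a \<omega> * of_bool (j \<le> d) - b \<omega> * of_bool (j > d))\<^sup>2"
  let ?F = "\<lambda>\<omega> d. \<Sum>j\<in>?S \<omega>. ?t \<omega> d j"
  let ?m = "\<lambda>\<omega>. {d \<in> ?S \<omega>. \<forall>d'\<in>?S \<omega>. ?F \<omega> d \<le> ?F \<omega> d'}"
  have S: "?S \<omega> \<subseteq> {1..N}" for \<omega> by (auto simp: window_def)
  have S_sets: "{\<omega> \<in> space M. d \<in> ?S \<omega>} \<in> sets M" for d
  proof (cases "d \<in> {1..N} \<and> \<not> skip K1 \<gamma> N dvd d")
    case True
    then have "{\<omega> \<in> space M. d \<in> ?S \<omega>} = {\<omega> \<in> space M. x \<omega> - r \<le> real d \<and> real d \<le> x \<omega> + r}"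
      unfolding window_def by simp
    moreover have "{\<omega> \<in> space M. x \<omega> - r \<le> real d \<and> real d \<le> x \<omega> + r} \<in> sets M"
      by (intro sets.sets_Collect_conj borel_measurable_le borel_measurable_diff borel_measurable_add
          borel_measurable_const x)
    ultimately show ?thesis by (simp only:)
  next
    case False
    then have "{\<omega> \<in> space M. d \<in> ?S \<omega>} = {}" unfolding window_def by blast
    then show ?thesis by (simp only: sets.empty_sets)
  qed
  have F_eq: "?F \<omega> d = (\<Sum>j\<in>{1..N}. if j \<in> ?S \<omega> then ?t \<omega> d j else 0)" for \<omega> d
  proof -
    have "{j \<in> {1..N}. j \<in> ?S \<omega>} = ?S \<omega>" using S by blast
    then show ?thesis
      using sum.inter_filter[of "{1..N}" "?t \<omega> d" "\<lambda>j. j \<in> ?S \<omega>"] by (simp only: finite_atLeastAtMost)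
  qed
  have F: "(\<lambda>\<omega>. ?F \<omega> d) \<in> borel_measurable M" for d
    unfolding F_eq
  proof (intro borel_measurable_sum measurable_If)
    fix j assume "j \<in> {1..N}"
    then show "(\<lambda>\<omega>. ?t \<omega> d j) \<in> borel_measurable M"
      by (intro borel_measurable_power borel_measurable_diff borel_measurable_times
          borel_measurable_const Y a b)
  qed (rule borel_measurable_const S_sets)+
  have mem: "{\<omega> \<in> space M. d \<in> ?m \<omega>} \<in> sets M" for d
  proof -
    have "{\<omega> \<in> space M. d' \<in> ?S \<omega> \<longrightarrow> ?F \<omega> d \<le> ?F \<omega> d'} \<in> sets M" for d'
      by (intro sets.sets_Collect_imp S_sets borel_measurable_le F)
    from sets.sets_Collect_countable_All[OF this]
    have "{\<omega> \<in> space M. \<forall>d'\<in>?S \<omega>. ?F \<omega> d \<le> ?F \<omega> d'} \<in> sets M"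
      unfolding Ball_def .
    from sets.sets_Collect_conj[OF this S_sets[of d]] show ?thesis by simp
  qed
  have "?m \<in> measurable M (count_space (Pow {1..N}))"
  proof (subst measurable_count_space_eq2)
    have "?m -` {B} \<inter> space M \<in> sets M" for B
    proof -
      have "{\<omega> \<in> space M. d \<in> ?m \<omega> \<longleftrightarrow> d \<in> B} \<in> sets M" for d
        using mem[of d] sets.sets_Collect_neg[OF mem[of d]] by (cases "d \<in> B") (simp_all only: simp_thms)
      from sets.sets_Collect_countable_All[OF this]
      have "{\<omega> \<in> space M. \<forall>d. d \<in> ?m \<omega> \<longleftrightarrow> d \<in> B} \<in> sets M" .
      moreover have "?m -` {B} \<inter> space M = {\<omega> \<in> space M. \<forall>d. d \<in> ?m \<omega> \<longleftrightarrow> d \<in> B}"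
        unfolding vimage_def set_eq_iff by blast
      ultimately show ?thesis by simp
    qed
    moreover have "?m \<in> space M \<rightarrow> Pow {1..N}" using S by blast
    ultimately show "?m \<in> space M \<rightarrow> Pow {1..N} \<and> (\<forall>B\<in>Pow {1..N}. ?m -` {B} \<inter> space M \<in> sets M)"
      by blast
  qed simp
  then have "(\<lambda>\<omega>. (\<lambda>A. SOME d. d \<in> A) (?m \<omega>)) \<in> measurable M (count_space UNIV)"
    by (rule measurable_compose) simp
  also have "(\<lambda>\<omega>. (\<lambda>A. SOME d. d \<in> A) (?m \<omega>))
      = (\<lambda>\<omega>. split_argmin (?S \<omega>) (\<lambda>j. Y j \<omega>) (a \<omega>) (b \<omega>))"
  proof
    fix \<omega>
    have "(\<lambda>d. d \<in> ?m \<omega>) = is_arg_min (?F \<omega>) (\<lambda>d. d \<in> ?S \<omega>)"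
      by (auto simp: is_arg_min_def fun_eq_iff not_less)
    then show "(\<lambda>A. SOME d. d \<in> A) (?m \<omega>) = split_argmin (?S \<omega>) (\<lambda>j. Y j \<omega>) (a \<omega>) (b \<omega>)"
      by (simp only: split_argmin_def arg_min_on_def arg_min_def)
  qed
  finally show ?thesis .
qed

text \<open>How the constants fit: a gap of \<open>4 * R' + 1\<close> indices yields
  \<open>2 * R'\<close> ranks, room for disjoint blocks of radius \<open>R'\<close>. Sites within
  \<open>R\<close> ranks lie within \<open>2 * R + 1 \<le> w\<close> indices of the change point,
  hence in the window; the window radius \<open>K * w\<close> plus the first-stage error
  \<open>w\<close> is at most \<open>R'\<close>. The margin is \<open>2 * \<rho>\<close>, at most
  \<open>D0 / 16\<close> as the tilt requires.\<close>

locale two_stage_sample = prob_space M for M :: "'a measure" +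
  fixes Y \<epsilon> :: "nat \<Rightarrow> 'a \<Rightarrow> real" and N J :: nat and \<tau> :: "nat \<Rightarrow> nat" and \<nu> \<sigma> :: "nat \<Rightarrow> real"
    and K1 \<gamma> :: real and Jhat :: "'a \<Rightarrow> nat" and \<tau>hat1 \<nu>hat1 :: "nat \<Rightarrow> 'a \<Rightarrow> real"
    and \<tau>hat2 :: "nat \<Rightarrow> 'a \<Rightarrow> nat" and w \<rho> :: real and K R R' :: nat
    and \<Delta> :: "nat \<Rightarrow> real" and D0 smin smax :: real
  assumes J: "J \<ge> 1" and \<tau>_first: "\<tau> 0 = 1" and \<tau>_last: "\<tau> (J + 1) = N"
    and Y: "\<And>j i \<omega>. j \<le> J \<Longrightarrow> i \<in> {\<tau> j<..\<tau> (j + 1)} \<Longrightarrow> \<omega> \<in> space M \<Longrightarrow> Y i \<omega> = \<nu> j + \<epsilon> i \<omega>"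
    and Y_meas: "\<And>i. i \<in> {1..N} \<Longrightarrow> Y i \<in> borel_measurable M"
    and indep: "indep_vars (\<lambda>_. borel) \<epsilon> {1..N}"
    and dist: "\<And>j i. j \<le> J \<Longrightarrow> i \<in> {\<tau> j<..\<tau> (j + 1)} \<Longrightarrow>
      distributed M lborel (\<epsilon> i) (normal_density 0 (\<sigma> j))"
    and \<sigma>: "\<And>j. smin \<le> \<sigma> j \<and> \<sigma> j \<le> smax" and smin: "smin > 0"
    and skip: "skip K1 \<gamma> N \<ge> 2"
    and gap: "\<And>j. j \<le> J \<Longrightarrow> \<tau> j + 4 * R' + 1 \<le> \<tau> (j + 1)"
    and K: "K > 1" and w: "2 * real R + 1 \<le> w" "(real K + 1) * w \<le> real R'"
    and \<rho>: "0 \<le> \<rho>" "2 * \<rho> \<le> D0 / 16"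
    and D0: "D0 > 0" "\<And>j. j \<in> {1..J} \<Longrightarrow> D0 \<le> \<Delta> j"
    and sep: "\<And>j. j \<in> {1..J} \<Longrightarrow> 2 * \<rho> < \<bar>\<nu> j - \<nu> (j - 1)\<bar>"
    and \<Delta>: "\<And>j. j \<in> {1..J} \<Longrightarrow> \<bar>\<Delta> j - \<bar>\<nu> j - \<nu> (j - 1)\<bar>\<bar> \<le> 2 * \<rho>"
    and Jhat_meas: "Jhat \<in> measurable M (count_space UNIV)"
    and hat1_meas: "\<And>i. \<tau>hat1 i \<in> borel_measurable M" "\<And>i. \<nu>hat1 i \<in> borel_measurable M"
    and \<tau>hat2: "\<And>i \<omega>. \<omega> \<in> space M \<Longrightarrow> i \<in> {1..Jhat \<omega>} \<Longrightarrow>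
      \<tau>hat2 i \<omega> = split_argmin (window K1 \<gamma> N (real K * w) (\<tau>hat1 i \<omega>))
        (\<lambda>j. Y j \<omega>) (\<nu>hat1 (i - 1) \<omega>) (\<nu>hat1 i \<omega>)"
begin

abbreviation "G \<equiv> off_grid K1 \<gamma> N"

definition centre :: "nat \<Rightarrow> nat" where "centre j = rank_in G (\<tau> j)"

definition site :: "nat \<Rightarrow> int \<Rightarrow> nat" where "site j u = of_rank G (nat (int (centre j) + u))"

abbreviation "I \<equiv> {- int R' + 1..int R'}"

text \<open>The sign orients the walk so that its drift is positive on both sides, whether the level
  jumps up or down; by symmetry it does not change the Gaussian law.\<close>

definition noise :: "nat \<times> int \<Rightarrow> 'a \<Rightarrow> real" where
  "noise p \<omega> = (case p of (j, u) \<Rightarrow>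
     (if u \<le> 0 then - sgn (\<nu> j - \<nu> (j - 1)) else sgn (\<nu> j - \<nu> (j - 1))) * \<epsilon> (site j u) \<omega>)"

lemma R_le: "R \<le> R'" and R'_pos: "R' > 0"
proof -
  have "1 \<le> w" using w(1) by linarith
  then have "1 * w \<le> (real K + 1) * w" using K by (intro mult_right_mono) auto
  then have "2 * real R + 1 \<le> real R'" using w by linarith
  then show "R \<le> R'" "R' > 0" by linarith+
qed

lemma \<tau>_strict: "i < j \<Longrightarrow> j \<le> J + 1 \<Longrightarrow> \<tau> i < \<tau> j"
proof (induction j)
  case (Suc j)
  then show ?case using gap[of j] by (cases "i = j") auto
qed auto

lemma \<tau>_le_N: "j \<le> J + 1 \<Longrightarrow> \<tau> j \<le> N"
  using \<tau>_strict[of j "J + 1"] \<tau>_last by (cases "j = J + 1") auto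

lemma centre_step:
  assumes "j \<le> J" shows "centre j + 2 * R' \<le> centre (j + 1)"
proof -
  have "\<tau> j \<le> \<tau> (j + 1)" using gap[OF assms] by simp
  from rank_off_grid_diff(2)[OF this \<tau>_le_N skip] rank_mono[OF finite_off_grid this, of K1 \<gamma> N] gap[OF assms]
  show ?thesis using assms unfolding centre_def by linarith
qed

lemma centre_gap: "i < j \<Longrightarrow> j \<le> J + 1 \<Longrightarrow> centre i + 2 * R' \<le> centre j"
proof (induction j)
  case (Suc j)
  then show ?case using centre_step[of j] by (cases "i = j") auto
qed auto

lemma centre_le_card: "centre j \<le> card G"
  unfolding centre_def rank_in_def by (intro card_mono) auto

lemma site:
  assumes j: "j \<in> {1..J}" and u: "u \<in> I"
  shows "site j u \<in> G" "int (rank_in G (site j u)) = int (centre j) + u"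
    "u \<le> 0 \<Longrightarrow> site j u \<in> {\<tau> (j - 1)<..\<tau> j}" "u > 0 \<Longrightarrow> site j u \<in> {\<tau> j<..\<tau> (j + 1)}"
proof -
  have gaps: "centre (j - 1) + 2 * R' \<le> centre j" "centre j + 2 * R' \<le> centre (j + 1)"
    using j centre_gap[of "j - 1" j] centre_gap[of j "j + 1"] by auto
  then have "nat (int (centre j) + u) \<in> {1..card G}"
    using u centre_le_card[of "j + 1"] by auto
  note of = of_rank[OF finite_off_grid this, folded site_def]
  show G: "site j u \<in> G" by (rule of(1))
  show rk: "int (rank_in G (site j u)) = int (centre j) + u" using of(2) u gaps by auto
  note iff = rank_le_iff[OF finite_off_grid G, folded centre_def]
  show "site j u \<in> {\<tau> (j - 1)<..\<tau> j}" if "u \<le> 0"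
    using iff[of "\<tau> j"] iff[of "\<tau> (j - 1)"] rk gaps u that unfolding centre_def by auto
  show "site j u \<in> {\<tau> j<..\<tau> (j + 1)}" if "u > 0"
    using iff[of "\<tau> j"] iff[of "\<tau> (j + 1)"] rk gaps u that unfolding centre_def by auto
qed

text \<open>The ranks of a block run from \<open>centre j - R'\<close>, exclusive, to
  \<open>centre j + R'\<close>, inclusive; centres at least \<open>2 * R'\<close> apart make these
  ranges disjoint.\<close>

lemma inj_on_site: "inj_on (\<lambda>(j, u). site j u) ({1..J} \<times> I)"
proof (rule inj_onI, clarify)
  fix i u j v assume *: "i \<in> {1..J}" "u \<in> I" "j \<in> {1..J}" "v \<in> I" "site i u = site j v"
  have eq: "int (centre i) + u = int (centre j) + v"
    using site(2)[OF *(1,2)] site(2)[OF *(3,4)] *(5) by simp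
  have "\<not> i < j" "\<not> j < i"
    using centre_gap[of i j] centre_gap[of j i] eq * by auto
  then have "i = j" by simp
  with eq show "i = j \<and> u = v" by simp
qed

lemma indep_noise: "indep_vars (\<lambda>_. borel) noise ({1..J} \<times> I)"
proof -
  have "(\<lambda>(j, u). site j u) ` ({1..J} \<times> I) \<subseteq> {1..N}"
    using site(1) by (auto simp: off_grid_def)
  from indep_vars_subset[OF indep this]
  have "indep_vars (\<lambda>_. borel) (\<lambda>p. \<epsilon> ((\<lambda>(j, u). site j u) p)) ({1..J} \<times> I)"
    by (rule indep_vars_reindex[OF inj_on_site])
  from indep_vars_compose2[OF this, of "\<lambda>p x. (case p of (j, u) \<Rightarrow>
     (if u \<le> 0 then - sgn (\<nu> j - \<nu> (j - 1)) else sgn (\<nu> j - \<nu> (j - 1)))) * x" "\<lambda>_. borel"]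
  show ?thesis unfolding noise_def split_beta by simp
qed

lemma distributed_noise:
  assumes j: "j \<in> {1..J}" and u: "u \<in> I"
  shows "distributed M lborel (noise (j, u)) (normal_density 0 (if u \<le> 0 then \<sigma> (j - 1) else \<sigma> j))"
proof -
  let ?s = "if u \<le> 0 then - sgn (\<nu> j - \<nu> (j - 1)) else sgn (\<nu> j - \<nu> (j - 1))"
  have s: "?s \<noteq> 0" "\<bar>?s\<bar> = 1" using sep[OF j] \<rho> by (auto simp: sgn_if)
  have d: "distributed M lborel (\<epsilon> (site j u)) (normal_density 0 (if u \<le> 0 then \<sigma> (j - 1) else \<sigma> j))"
    using dist[of "j - 1" "site j u"] dist[of j "site j u"] site(3,4)[OF j u] j by auto
  have "(if u \<le> 0 then \<sigma> (j - 1) else \<sigma> j) > 0" using \<sigma> smin by (auto intro: less_le_trans)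
  from normal_density_affine[OF d this s(1), of 0] s(2)
  have "distributed M lborel (\<lambda>\<omega>. ?s * \<epsilon> (site j u) \<omega>)
      (normal_density 0 (if u \<le> 0 then \<sigma> (j - 1) else \<sigma> j))"
    by simp
  moreover have "noise (j, u) = (\<lambda>\<omega>. ?s * \<epsilon> (site j u) \<omega>)"
    by (simp add: noise_def fun_eq_iff)
  ultimately show ?thesis by (simp only:)
qed

lemma window_off_grid: "window K1 \<gamma> N r x = {d \<in> G. x - r \<le> real d \<and> real d \<le> x + r}"
  by (auto simp: window_def off_grid_def)

lemma rank_dist:
  assumes "x \<le> N" "y \<le> N"
  shows "\<bar>int (rank_in G x) - int (rank_in G y)\<bar> \<le> \<bar>int x - int y\<bar>"
    and "\<bar>int x - int y\<bar> \<le> 2 * \<bar>int (rank_in G x) - int (rank_in G y)\<bar> + 1"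
proof -
  have *: "\<bar>int (rank_in G x) - int (rank_in G y)\<bar> \<le> \<bar>int x - int y\<bar> \<and>
     \<bar>int x - int y\<bar> \<le> 2 * \<bar>int (rank_in G x) - int (rank_in G y)\<bar> + 1" if "x \<le> y" "y \<le> N" for x y
  proof -
    have le: "rank_in G x \<le> rank_in G y" using that(1) by (rule rank_mono[OF finite_off_grid])
    from le obtain l where l: "rank_in G y = rank_in G x + l" using le_Suc_ex by blast
    from that(1) obtain k where k: "y = x + k" using le_Suc_ex by blast
    have "l \<le> k" "k \<le> 2 * l + 1"
      using rank_off_grid_diff[OF that skip] l k by simp_all
    then show ?thesis using l k by simp
  qed
  from *[of x y] *[of y x] assms le_cases[of x y]
  show "\<bar>int (rank_in G x) - int (rank_in G y)\<bar> \<le> \<bar>int x - int y\<bar>"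
    "\<bar>int x - int y\<bar> \<le> 2 * \<bar>int (rank_in G x) - int (rank_in G y)\<bar> + 1" by (metis abs_minus_commute)+
qed

definition consistent :: "'a \<Rightarrow> bool" where
  "consistent \<omega> \<longleftrightarrow> Jhat \<omega> = J \<and> (\<forall>i\<in>{1..J}. \<bar>\<tau>hat1 i \<omega> - real (\<tau> i)\<bar> \<le> w) \<and>
     (\<forall>i\<in>{0..J}. \<bar>\<nu>hat1 i \<omega> - \<nu> i\<bar> \<le> \<rho>)"

text \<open>Holds pointwise on the first-stage event, so any dependence between the first-stage
  estimates and the noise is harmless.\<close>

lemma lambda2_eq_clear_min:
  assumes \<omega>: "\<omega> \<in> space M" "consistent \<omega>" and j: "j \<in> {1..J}"
    and clear: "clear_min (\<Delta> j) (2 * \<rho>) {- int R'..int R'} (\<lambda>u. noise (j, u) \<omega>) L" and L: "\<bar>L\<bar> \<le> int R"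
  shows "lambda2 K1 \<gamma> N (\<tau> j) (\<tau>hat2 j \<omega>) = L"
proof -
  let ?S = "window K1 \<gamma> N (real K * w) (\<tau>hat1 j \<omega>)"
  have hat: "\<bar>\<tau>hat1 j \<omega> - real (\<tau> j)\<bar> \<le> w" and \<nu>hat: "\<bar>\<nu>hat1 (j - 1) \<omega> - \<nu> (j - 1)\<bar> \<le> \<rho>" "\<bar>\<nu>hat1 j \<omega> - \<nu> j\<bar> \<le> \<rho>"
    and "Jhat \<omega> = J"
    using \<omega>(2) j unfolding consistent_def by auto
  have \<tau>j: "\<tau> j \<le> N" using j \<tau>_le_N by simp
  have gaps: "centre (j - 1) + 2 * R' \<le> centre j" "centre j + 2 * R' \<le> centre (j + 1)"
    using j centre_gap[of "j - 1" j] centre_gap[of j "j + 1"] by auto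
  have "int (rank_in G (split_argmin ?S (\<lambda>i. Y i \<omega>) (\<nu>hat1 (j - 1) \<omega>) (\<nu>hat1 j \<omega>))) - int (rank_in G (\<tau> j)) = L"
  proof (rule split_argmin_rank[where \<epsilon> = "\<lambda>i. \<epsilon> i \<omega>" and \<mu> = "\<nu> (j - 1)" and \<mu>' = "\<nu> j" and R = R and R' = R'
        and \<rho> = \<rho> and \<Delta> = "\<Delta> j"])
    show "?S = {d \<in> G. \<tau>hat1 j \<omega> - real K * w \<le> real d \<and> real d \<le> \<tau>hat1 j \<omega> + real K * w}"
      by (rule window_off_grid)
    fix d assume d: "d \<in> ?S"
    then have dG: "d \<le> N" and "\<bar>real d - \<tau>hat1 j \<omega>\<bar> \<le> real K * w" by (auto simp: window_def)
    then have "\<bar>real d - real (\<tau> j)\<bar> \<le> (real K + 1) * w" using hat by (simp add: distrib_right)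
    then have "real_of_int \<bar>int d - int (\<tau> j)\<bar> \<le> real_of_int (int R')" using w(2) by simp
    then have "\<bar>int d - int (\<tau> j)\<bar> \<le> int R'" by (simp only: of_int_le_iff)
    then show "\<bar>int (rank_in G d) - int (rank_in G (\<tau> j))\<bar> \<le> int R'"
      using rank_dist(1)[OF dG \<tau>j] by linarith
  next
    fix d assume d: "d \<in> G" "\<bar>int (rank_in G d) - int (rank_in G (\<tau> j))\<bar> \<le> int R"
    then have "d \<le> N" by (simp add: off_grid_def)
    from rank_dist(2)[OF this \<tau>j] have "\<bar>int d - int (\<tau> j)\<bar> \<le> 2 * \<bar>int (rank_in G d) - int (rank_in G (\<tau> j))\<bar> + 1" .
    also have "\<dots> \<le> 2 * int R + 1" using d(2) by simp
    finally have "real_of_int \<bar>int d - int (\<tau> j)\<bar> \<le> real_of_int (2 * int R + 1)" by (simp only: of_int_le_iff)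
    then have "\<bar>real d - real (\<tau> j)\<bar> \<le> 2 * real R + 1" by simp
    then have "\<bar>real d - \<tau>hat1 j \<omega>\<bar> \<le> 2 * w" using w(1) hat by linarith
    \<comment> \<open>\<open>K\<close> is an integer, so \<open>K > 1\<close> gives
      \<open>K \<ge> 2\<close>: one \<open>w\<close> for the first-stage error and one for the sites
      within \<open>R\<close>.\<close>
    also have "2 * w \<le> real K * w" using K w(1) by (intro mult_right_mono) auto
    finally show "d \<in> ?S" using d(1) by (auto simp: window_off_grid abs_le_iff)
  next
    fix u assume u: "u \<in> I"
    show "Y (of_rank G (nat (int (rank_in G (\<tau> j)) + u))) \<omega>
      = (if u \<le> 0 then \<nu> (j - 1) else \<nu> j) + \<epsilon> (of_rank G (nat (int (rank_in G (\<tau> j)) + u))) \<omega>"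
      using Y[of "j - 1" "site j u" \<omega>] Y[of j "site j u" \<omega>] site(3,4)[OF j u] j \<omega>(1)
      unfolding site_def centre_def by auto
  next
    show "clear_min (\<Delta> j) (2 * \<rho>) {- int R'..int R'} (\<lambda>u. (if u \<le> 0 then - sgn (\<nu> j - \<nu> (j - 1)) else sgn (\<nu> j - \<nu> (j - 1)))
        * \<epsilon> (of_rank G (nat (int (rank_in G (\<tau> j)) + u))) \<omega>) L"
      using clear by (simp add: noise_def site_def centre_def)
    show "int R' \<le> int (rank_in G (\<tau> j))" using gaps unfolding centre_def by linarith
    show "int (rank_in G (\<tau> j)) + int R' \<le> int (card G)"
      using gaps centre_le_card[of "j + 1"] unfolding centre_def by linarith
    show "1 \<le> int (rank_in G (\<tau> j)) + L" using gaps L R_le R'_pos unfolding centre_def by linarith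
  qed (use \<nu>hat sep[OF j] \<Delta>[OF j] L R_le in auto)
  then show ?thesis
    using \<tau>hat2[OF \<omega>(1), of j] j \<open>Jhat \<omega> = J\<close> by (simp add: lambda2_eq_rank)
qed

definition err :: real where
  "err = walk_bounds.unclear_const D0 smin smax * (2 * \<rho> + exp (- walk_bounds.rate D0 smax * real R))"

lemma walk_bounds: "j \<in> {1..J} \<Longrightarrow> walk_bounds D0 smin smax (\<Delta> j) (\<sigma> (j - 1)) (\<sigma> j)"
  using D0 \<sigma> smin by unfold_locales auto

abbreviation "W j \<equiv> walk_noise (\<sigma> (j - 1)) (\<sigma> j)"

lemma sets_decided_PiM:
  "{x \<in> space (\<Pi>\<^sub>M i\<in>I. borel). decided D (2 * \<rho>) R R' q x} \<in> sets (\<Pi>\<^sub>M i\<in>I. borel)"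
  by (intro sets_decided R_le borel_measurable_walk_PiM)

text \<open>Stated for a general index set: singletons give the individual error probabilities, the
  full range gives the product.\<close>

lemma decided_event:
  assumes "A \<subseteq> {1..J}" "A \<noteq> {}"
  shows "{\<omega> \<in> space M. \<forall>j\<in>A. decided (\<Delta> j) (2 * \<rho>) R R' (q j) (\<lambda>u. noise (j, u) \<omega>)} \<in> sets M"
    and "prob {\<omega> \<in> space M. \<forall>j\<in>A. decided (\<Delta> j) (2 * \<rho>) R R' (q j) (\<lambda>u. noise (j, u) \<omega>)}
      = (\<Prod>j\<in>A. measure (W j) {e \<in> space (W j). decided (\<Delta> j) (2 * \<rho>) R R' (q j) e})"
proof -
  have fin: "finite A" "finite I" "I \<noteq> {}" using assms(1) R'_pos by (auto intro: finite_subset)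
  have ind: "indep_vars (\<lambda>_. borel) noise (A \<times> I)"
    using assms(1) by (intro indep_vars_subset[OF indep_noise]) auto
  have pos: "\<sigma> j > 0" for j using \<sigma>[of j] smin by linarith
  note blocks = prob_gaussian_blocks[OF fin(1) assms(2) fin(2,3) ind, of "\<lambda>j. \<sigma> (j - 1)" \<sigma>
      "\<lambda>j. decided (\<Delta> j) (2 * \<rho>) R R' (q j)"]
  show "{\<omega> \<in> space M. \<forall>j\<in>A. decided (\<Delta> j) (2 * \<rho>) R R' (q j) (\<lambda>u. noise (j, u) \<omega>)} \<in> sets M"
    using distributed_noise pos decided_restrict[OF R_le] sets_decided_PiM assms(1) by (intro blocks(1)) blast+
  show "prob {\<omega> \<in> space M. \<forall>j\<in>A. decided (\<Delta> j) (2 * \<rho>) R R' (q j) (\<lambda>u. noise (j, u) \<omega>)}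
      = (\<Prod>j\<in>A. measure (W j) {e \<in> space (W j). decided (\<Delta> j) (2 * \<rho>) R R' (q j) e})"
    using distributed_noise pos decided_restrict[OF R_le] sets_decided_PiM assms(1) by (intro blocks(2)) blast+
qed

lemma undecided_event:
  assumes "j \<in> {1..J}"
  shows "{\<omega> \<in> space M. \<not> decided (\<Delta> j) (2 * \<rho>) R R' R (\<lambda>u. noise (j, u) \<omega>)} \<in> sets M"
    and "prob {\<omega> \<in> space M. \<not> decided (\<Delta> j) (2 * \<rho>) R R' R (\<lambda>u. noise (j, u) \<omega>)} \<le> err"
proof -
  interpret wb: walk_bounds D0 smin smax "\<Delta> j" "\<sigma> (j - 1)" "\<sigma> j" by (rule walk_bounds[OF assms])
  let ?D = "{\<omega> \<in> space M. decided (\<Delta> j) (2 * \<rho>) R R' R (\<lambda>u. noise (j, u) \<omega>)}"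
  let ?E = "{e \<in> space (W j). decided (\<Delta> j) (2 * \<rho>) R R' R e}"
  have D: "?D \<in> sets M" "prob ?D = measure (W j) ?E"
    using decided_event[of "{j}" "\<lambda>_. R"] assms by auto
  have "{\<omega> \<in> space M. \<not> decided (\<Delta> j) (2 * \<rho>) R R' R (\<lambda>u. noise (j, u) \<omega>)} = space M - ?D" by auto
  with D(1) show "{\<omega> \<in> space M. \<not> decided (\<Delta> j) (2 * \<rho>) R R' R (\<lambda>u. noise (j, u) \<omega>)} \<in> sets M" by simp
  have "prob {\<omega> \<in> space M. \<not> decided (\<Delta> j) (2 * \<rho>) R R' R (\<lambda>u. noise (j, u) \<omega>)} = 1 - measure (W j) ?E"
    using D prob_compl[OF D(1)] \<open>_ = space M - ?D\<close> by simp
  also have "\<dots> = measure (W j) (space (W j) - ?E)"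
    by (rule wb.W.prob_compl[symmetric]) (rule wb.decided_sets[OF R_le])
  also have "space (W j) - ?E = {e \<in> space (W j). \<not> decided (\<Delta> j) (2 * \<rho>) R R' R e}" by auto
  also have "measure (W j) \<dots> \<le> err"
    unfolding err_def using \<rho> by (intro wb.undecided_prob R_le) auto
  finally show "prob {\<omega> \<in> space M. \<not> decided (\<Delta> j) (2 * \<rho>) R R' R (\<lambda>u. noise (j, u) \<omega>)} \<le> err" .
qed

text \<open>Products of numbers in the unit interval differ by at most the sum of the differences of
  their factors, so the error grows only linearly in \<open>J\<close>.\<close>

lemma prod_decided:
  "\<bar>(\<Prod>j\<in>{1..J}. measure (W j) {e \<in> space (W j). decided (\<Delta> j) (2 * \<rho>) R R' (q j) e})
    - (\<Prod>j\<in>{1..J}. walk_cdf (\<Delta> j) (\<sigma> (j - 1)) (\<sigma> j) (q j))\<bar> \<le> real J * err"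
proof -
  have pos: "\<sigma> j > 0" for j using \<sigma>[of j] smin by linarith
  have le1: "norm (measure (W j) X) \<le> 1" for j X
    using prob_space.prob_le_1[OF prob_space_walk_noise[OF pos pos]] by simp
  have "norm ((\<Prod>j\<in>{1..J}. measure (W j) {e \<in> space (W j). decided (\<Delta> j) (2 * \<rho>) R R' (q j) e})
      - (\<Prod>j\<in>{1..J}. walk_cdf (\<Delta> j) (\<sigma> (j - 1)) (\<sigma> j) (q j)))
    \<le> (\<Sum>j\<in>{1..J}. norm (measure (W j) {e \<in> space (W j). decided (\<Delta> j) (2 * \<rho>) R R' (q j) e}
      - walk_cdf (\<Delta> j) (\<sigma> (j - 1)) (\<sigma> j) (q j)))"
    unfolding walk_cdf_def by (intro norm_prod_diff le1)
  also have "\<dots> \<le> (\<Sum>j\<in>{1..J}. err)"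
  proof (intro sum_mono)
    fix j assume "j \<in> {1..J}"
    then interpret wb: walk_bounds D0 smin smax "\<Delta> j" "\<sigma> (j - 1)" "\<sigma> j" by (rule walk_bounds)
    show "norm (measure (W j) {e \<in> space (W j). decided (\<Delta> j) (2 * \<rho>) R R' (q j) e}
      - walk_cdf (\<Delta> j) (\<sigma> (j - 1)) (\<sigma> j) (q j)) \<le> err"
      unfolding err_def real_norm_def using \<rho> by (intro wb.decided_prob R_le) auto
  qed
  also have "\<dots> = real J * err" by simp
  finally show ?thesis by simp
qed

lemma sets_consistent: "{\<omega> \<in> space M. consistent \<omega>} \<in> sets M"
proof -
  have "{\<omega> \<in> space M. Jhat \<omega> = J} \<in> sets M"
    using measurable_sets[OF Jhat_meas, of "{J}"] by (simp add: vimage_def Int_def conj_commute)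
  then show ?thesis
    unfolding consistent_def
    by (intro sets.sets_Collect_conj sets.sets_Collect_countable_Ball borel_measurable_le
        borel_measurable_abs borel_measurable_diff borel_measurable_const hat1_meas)
qed

lemma sets_target:
  "{\<omega> \<in> space M. Jhat \<omega> = J \<and> (\<forall>j\<in>{1..J}. \<bar>lambda2 K1 \<gamma> N (\<tau> j) (\<tau>hat2 j \<omega>)\<bar> \<le> int (q j))} \<in> sets M"
proof -
  let ?T = "\<lambda>j \<omega>. split_argmin (window K1 \<gamma> N (real K * w) (\<tau>hat1 j \<omega>)) (\<lambda>i. Y i \<omega>) (\<nu>hat1 (j - 1) \<omega>) (\<nu>hat1 j \<omega>)"
  have J_sets: "{\<omega> \<in> space M. Jhat \<omega> = J} \<in> sets M"
    using measurable_sets[OF Jhat_meas, of "{J}"] by (simp add: vimage_def Int_def conj_commute)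
  have "?T j \<in> measurable M (count_space UNIV)" for j
    by (intro measurable_split_argmin hat1_meas Y_meas)
  from measurable_sets[OF this, of "{d. \<bar>lambda2 K1 \<gamma> N (\<tau> j) d\<bar> \<le> int (q j)}" for j]
  have "{\<omega> \<in> space M. \<bar>lambda2 K1 \<gamma> N (\<tau> j) (?T j \<omega>)\<bar> \<le> int (q j)} \<in> sets M" for j
    by (simp add: vimage_def Int_def conj_commute)
  then have "{\<omega> \<in> space M. Jhat \<omega> = J \<and> (\<forall>j\<in>{1..J}. \<bar>lambda2 K1 \<gamma> N (\<tau> j) (?T j \<omega>)\<bar> \<le> int (q j))} \<in> sets M"
    by (intro sets.sets_Collect_conj J_sets sets.sets_Collect_countable_Ball)
  \<comment> \<open>\<open>\<tau>hat2\<close> is specified only up to \<open>Jhat\<close>, so the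
    replacement by the explicit minimiser relies on \<open>Jhat \<omega> = J\<close>.\<close>
  also have "{\<omega> \<in> space M. Jhat \<omega> = J \<and> (\<forall>j\<in>{1..J}. \<bar>lambda2 K1 \<gamma> N (\<tau> j) (?T j \<omega>)\<bar> \<le> int (q j))}
    = {\<omega> \<in> space M. Jhat \<omega> = J \<and> (\<forall>j\<in>{1..J}. \<bar>lambda2 K1 \<gamma> N (\<tau> j) (\<tau>hat2 j \<omega>)\<bar> \<le> int (q j))}"
    using \<tau>hat2 by auto
  finally show ?thesis .
qed

text \<open>Off the exceptional set \<open>?C\<close>, coverage coincides with the certificates. One
  \<open>real J * err\<close> is the union bound over undecided walks, the other the passage from
  certificates to \<open>walk_cdf\<close>.\<close>

lemma coverage_error:
  "\<bar>prob {\<omega> \<in> space M. Jhat \<omega> = J \<and> (\<forall>j\<in>{1..J}. \<bar>lambda2 K1 \<gamma> N (\<tau> j) (\<tau>hat2 j \<omega>)\<bar> \<le> int (q j))}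
    - (\<Prod>j\<in>{1..J}. walk_cdf (\<Delta> j) (\<sigma> (j - 1)) (\<sigma> j) (q j))\<bar>
   \<le> (1 - prob {\<omega> \<in> space M. consistent \<omega>}) + 2 * (real J * err)"
proof -
  let ?E = "{\<omega> \<in> space M. Jhat \<omega> = J \<and> (\<forall>j\<in>{1..J}. \<bar>lambda2 K1 \<gamma> N (\<tau> j) (\<tau>hat2 j \<omega>)\<bar> \<le> int (q j))}"
  let ?dec = "\<lambda>q j \<omega>. decided (\<Delta> j) (2 * \<rho>) R R' q (\<lambda>u. noise (j, u) \<omega>)"
  let ?T = "{\<omega> \<in> space M. \<forall>j\<in>{1..J}. ?dec (q j) j \<omega>}"
  let ?U = "\<lambda>j. {\<omega> \<in> space M. \<not> ?dec R j \<omega>}"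
  let ?A = "{\<omega> \<in> space M. consistent \<omega>}"
  let ?C = "(space M - ?A) \<union> (\<Union>j\<in>{1..J}. ?U j)"
  have ne: "{1..J} \<noteq> {}" using J by simp
  have U: "(\<Union>j\<in>{1..J}. ?U j) \<in> sets M" using undecided_event(1) by (intro sets.finite_UN) auto
  have A: "?A \<in> sets M" "space M - ?A \<in> sets M" using sets_consistent by auto
  have iff: "\<omega> \<in> ?E \<longleftrightarrow> \<omega> \<in> ?T" if \<omega>: "\<omega> \<in> space M" "\<omega> \<notin> ?C" for \<omega>
  proof -
    have cons: "consistent \<omega>" using \<omega> by blast
    have dec: "\<bar>lambda2 K1 \<gamma> N (\<tau> j) (\<tau>hat2 j \<omega>)\<bar> \<le> int (q j) \<longleftrightarrow> ?dec (q j) j \<omega>" if j: "j \<in> {1..J}" for j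
    proof -
      have "?dec R j \<omega>" using \<omega> j by blast
      then obtain L where L: "L \<in> {- int R..int R}"
          "clear_min (\<Delta> j) (2 * \<rho>) {- int R'..int R'} (\<lambda>u. noise (j, u) \<omega>) L"
        by (auto simp: decided_def)
      have "lambda2 K1 \<gamma> N (\<tau> j) (\<tau>hat2 j \<omega>) = L"
        using L by (intro lambda2_eq_clear_min \<omega> cons j) auto
      moreover have "?dec (q j) j \<omega> \<longleftrightarrow> \<bar>L\<bar> \<le> int (q j)"
      proof
        assume "?dec (q j) j \<omega>"
        then obtain L' where L': "L' \<in> {- int (min R (q j))..int (min R (q j))}"
            "clear_min (\<Delta> j) (2 * \<rho>) {- int R'..int R'} (\<lambda>u. noise (j, u) \<omega>) L'"
          unfolding decided_def by blast
        have "L' = L" using L(1) L'(1) R_le \<rho> by (intro clear_min_unique[OF L'(2) L(2)]) auto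
        then show "\<bar>L\<bar> \<le> int (q j)" using L' by auto
      next
        assume "\<bar>L\<bar> \<le> int (q j)"
        then have "L \<in> {- int (min R (q j))..int (min R (q j))}" using L(1) by auto
        then show "?dec (q j) j \<omega>" unfolding decided_def using L(2) by blast
      qed
      ultimately show ?thesis by simp
    qed
    have "Jhat \<omega> = J" using cons by (simp add: consistent_def)
    then show ?thesis using \<omega>(1) dec by simp
  qed
  have "\<bar>prob ?E - prob ?T\<bar> \<le> prob ?C"
  proof (rule abs_measure_diff_le)
    show "?E \<subseteq> ?T \<union> ?C" using iff by blast
    show "?T \<subseteq> ?E \<union> ?C" using iff by blast
  qed (use sets_target decided_event(1)[OF order_refl ne] U A in auto)
  also have "prob ?C \<le> prob (space M - ?A) + prob (\<Union>j\<in>{1..J}. ?U j)"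
    using A U by (intro measure_Un_le)
  also have "prob (space M - ?A) = 1 - prob ?A" using A(1) by (rule prob_compl)
  also have "prob (\<Union>j\<in>{1..J}. ?U j) \<le> (\<Sum>j\<in>{1..J}. prob (?U j))"
    using undecided_event(1) by (intro finite_measure_subadditive_finite) auto
  also have "\<dots> \<le> (\<Sum>j\<in>{1..J}. err)" by (intro sum_mono undecided_event(2))
  also have "\<dots> = real J * err" by simp
  finally have 1: "\<bar>prob ?E - prob ?T\<bar> \<le> 1 - prob ?A + real J * err" by simp
  have "prob ?T = (\<Prod>j\<in>{1..J}. measure (W j) {e \<in> space (W j). decided (\<Delta> j) (2 * \<rho>) R R' (q j) e})"
    by (rule decided_event(2)[OF order_refl ne])
  then show ?thesis using 1 prod_decided[of q] by linarith
qed

end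

subsection \<open>Asymptotics\<close>

lemma statistic_of_measurable:
  assumes "statistic_of M Y G L T" "\<And>i. i \<in> G \<Longrightarrow> Y i \<in> borel_measurable M"
  shows "T \<in> measurable M L"
proof -
  obtain f where f: "f \<in> measurable (\<Pi>\<^sub>M i\<in>G. borel) L" "\<And>\<omega>. \<omega> \<in> space M \<Longrightarrow> T \<omega> = f (\<lambda>i\<in>G. Y i \<omega>)"
    using assms(1) unfolding statistic_of_def by blast
  have "(\<lambda>\<omega>. \<lambda>i\<in>G. Y i \<omega>) \<in> measurable M (\<Pi>\<^sub>M i\<in>G. borel)"
    using assms(2) by (rule measurable_restrict)
  from measurable_compose[OF this f(1)] show ?thesis
    by (rule measurable_cong[THEN iffD2, rotated]) (rule f(2))
qed

lemma strict_chain_bounds: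
  fixes t :: "nat \<Rightarrow> nat"
  assumes "\<And>j. j \<le> n \<Longrightarrow> t j < t (j + 1)"
  shows "j \<le> n + 1 \<Longrightarrow> t 0 + j \<le> t j" "j \<le> n + 1 \<Longrightarrow> t j \<le> t (n + 1)"
proof -
  show "t 0 + j \<le> t j" if "j \<le> n + 1"
    using that
  proof (induction j)
    case (Suc j)
    then show ?case using assms[of j] by simp
  qed simp
  show "t j \<le> t (n + 1)" if "j \<le> n + 1"
    using that
  proof (induction rule: inc_induct)
    case (step m)
    then show ?case using assms[of m] by simp
  qed simp
qed

lemma real_nat_ceiling_le:
  fixes x :: real
  assumes "0 \<le> x" shows "real (nat \<lceil>x\<rceil>) \<le> x + 1"
  using assms by linarith

lemma real_nat_floor_ge:
  fixes x :: real
  shows "x - 1 \<le> real (nat \<lfloor>x\<rfloor>)"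
  by linarith

text \<open>Here \<open>N\<close> bounds the number of change points and the bracket bounds
  \<open>R \<ge> (w - 3) / 2\<close> from below: the exponential beats the union over change
  points.\<close>

lemma tendsto_mult_exp_neg_powr:
  fixes r c \<gamma> :: real
  assumes "r > 0" "c > 0" "\<gamma> < 1"
  shows "(\<lambda>N. real N * exp (- r * ((c * real N powr (1 - \<gamma>) - 3) / 2))) \<longlonglongrightarrow> 0"
  using assms by real_asymp

lemma filterlim_skip_ratio:
  fixes K1 \<gamma> :: real
  assumes "K1 > 0" "\<gamma> < 1"
  shows "filterlim (\<lambda>N. real N / (K1 * real N powr \<gamma>)) at_top sequentially"
  using assms by real_asymp

theorem theorem5:
  fixes M :: "nat \<Rightarrow> 'a measure"
    and Y \<epsilon> :: "nat \<Rightarrow> nat \<Rightarrow> 'a \<Rightarrow> real"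
    and \<theta> \<nu> :: "nat \<Rightarrow> nat \<Rightarrow> real"
    and \<tau> :: "nat \<Rightarrow> nat \<Rightarrow> nat"
    and J :: "nat \<Rightarrow> nat"
    and \<sigma> :: "nat \<Rightarrow> real"
    and \<theta>_max \<Delta>_min \<Xi> C \<sigma>_min \<sigma>_max K1 \<gamma> c \<alpha> :: real
    and Jhat :: "nat \<Rightarrow> 'a \<Rightarrow> nat"
    and \<tau>hat1 \<nu>hat1 :: "nat \<Rightarrow> nat \<Rightarrow> 'a \<Rightarrow> real"
    and \<tau>hat2 :: "nat \<Rightarrow> nat \<Rightarrow> 'a \<Rightarrow> nat"
    and w \<rho> :: "nat \<Rightarrow> real"
    and K :: nat
  assumes prob_space: "\<And>N. N \<ge> 3 \<Longrightarrow> prob_space (M N)"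
    and observations: "\<And>N i \<omega>. N \<ge> 3 \<Longrightarrow> i \<in> {1..N} \<Longrightarrow> \<omega> \<in> space (M N) \<Longrightarrow>
          Y N i \<omega> = \<theta> N i + \<epsilon> N i \<omega>"
    and change_points: "\<And>N. N \<ge> 3 \<Longrightarrow> J N \<ge> 1 \<and> \<tau> N 0 = 1 \<and> \<tau> N (J N + 1) = N \<and>
          (\<forall>j\<in>{0..J N}. \<tau> N j < \<tau> N (j + 1))"
    and levels: "\<And>N. N \<ge> 3 \<Longrightarrow> \<theta> N 1 = \<nu> N 0 \<and>
          (\<forall>j\<in>{0..J N}. \<forall>i\<in>{\<tau> N j<..\<tau> N (j + 1)}. \<theta> N i = \<nu> N j)"
    and M1: "\<theta>_max > 0" "\<And>N i. N \<ge> 3 \<Longrightarrow> i \<in> {1..N} \<Longrightarrow> \<bar>\<theta> N i\<bar> \<le> \<theta>_max"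
    and M2: "\<Delta>_min > 0"
          "\<And>N j. N \<ge> 3 \<Longrightarrow> j \<in> {1..J N} \<Longrightarrow> \<bar>\<nu> N j - \<nu> N (j - 1)\<bar> \<ge> \<Delta>_min"
    and M3: "0 \<le> \<Xi>" "\<Xi> < 1" "C > 0"
          "\<forall>\<^sub>F N in sequentially. real (min_gap (\<tau> N) (J N)) \<ge> C * real N powr (1 - \<Xi>)"
    and M4_Gaussian: "\<sigma>_min > 0" "\<sigma>_max > 0"
          "\<And>N. N \<ge> 3 \<Longrightarrow> prob_space.indep_vars (M N) (\<lambda>_. borel) (\<epsilon> N) {1..N}"
          "\<And>N i. N \<ge> 3 \<Longrightarrow> i \<in> {1..N} \<Longrightarrow>
             \<exists>s. \<sigma>_min \<le> s \<and> s \<le> \<sigma>_max \<and> distributed (M N) lborel (\<epsilon> N i) (normal_density 0 s)"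
    and M6: "\<And>j. \<sigma>_min \<le> \<sigma> j \<and> \<sigma> j \<le> \<sigma>_max"
          "\<And>N j i. N \<ge> 3 \<Longrightarrow> j \<in> {0..J N} \<Longrightarrow> i \<in> {\<tau> N j<..\<tau> N (j + 1)} \<Longrightarrow>
             distributed (M N) lborel (\<epsilon> N i) (normal_density 0 (\<sigma> j))"
    and sampling: "K1 > 0" "\<Xi> < \<gamma>" "\<gamma> < 1"
          "(\<lambda>N. real N / (K1 * real N powr \<gamma>)) \<in> o(\<lambda>N. real (min_gap (\<tau> N) (J N)))"
    and first_stage:
          "\<And>N. N \<ge> 3 \<Longrightarrow> statistic_of (M N) (Y N) (grid K1 \<gamma> N) (count_space UNIV) (Jhat N)"
          "\<And>N i. N \<ge> 3 \<Longrightarrow> statistic_of (M N) (Y N) (grid K1 \<gamma> N) borel (\<tau>hat1 N i)"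
          "\<And>N i. N \<ge> 3 \<Longrightarrow> statistic_of (M N) (Y N) (grid K1 \<gamma> N) borel (\<nu>hat1 N i)"
    and window_width: "filterlim w at_top sequentially"
          "w \<in> o(\<lambda>N. real (min_gap (\<tau> N) (J N)))"
          "c > 0" "\<And>N. N \<ge> 3 \<Longrightarrow> w N \<ge> c * real N powr (1 - \<gamma>)"
    and level_rate: "\<rho> \<longlonglongrightarrow> 0" "(\<lambda>N. real (J N) * \<rho> N) \<longlonglongrightarrow> 0"
    and first_stage_consistency:
          "(\<lambda>N. measure (M N) {\<omega> \<in> space (M N). Jhat N \<omega> = J N \<and>
              (\<forall>i\<in>{1..J N}. \<bar>\<tau>hat1 N i \<omega> - real (\<tau> N i)\<bar> \<le> w N) \<and>
              (\<forall>i\<in>{0..J N}. \<bar>\<nu>hat1 N i \<omega> - \<nu> N i\<bar> \<le> \<rho> N)}) \<longlonglongrightarrow> 1"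
    and second_stage: "K > 1"
          "\<And>N i \<omega>. N \<ge> 3 \<Longrightarrow> \<omega> \<in> space (M N) \<Longrightarrow> i \<in> {1..Jhat N \<omega>} \<Longrightarrow>
             \<tau>hat2 N i \<omega> = split_argmin (window K1 \<gamma> N (real K * w N) (\<tau>hat1 N i \<omega>))
               (\<lambda>j. Y N j \<omega>) (\<nu>hat1 N (i - 1) \<omega>) (\<nu>hat1 N i \<omega>)"
    and alpha: "0 < \<alpha>" "\<alpha> < 1"
  shows "(\<lambda>N. measure (M N) {\<omega> \<in> space (M N). Jhat N \<omega> = J N \<and>
              (\<forall>j\<in>{1..J N}. \<bar>lambda2 K1 \<gamma> N (\<tau> N j) (\<tau>hat2 N j \<omega>)\<bar>
                 \<le> int (walk_Q (\<bar>\<nu> N j - \<nu> N (j - 1)\<bar> - 2 * \<rho> N) (\<sigma> (j - 1)) (\<sigma> j) (root (J N) (1 - \<alpha>))))}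
            - (\<Prod>j\<in>{1..J N}. walk_P (\<bar>\<nu> N j - \<nu> N (j - 1)\<bar> - 2 * \<rho> N) (\<sigma> (j - 1)) (\<sigma> j) (root (J N) (1 - \<alpha>))))
           \<longlonglongrightarrow> 0
       \<and> (\<lambda>N. measure (M N) {\<omega> \<in> space (M N). Jhat N \<omega> = J N \<and>
              (\<forall>j\<in>{1..J N}. \<bar>lambda2 K1 \<gamma> N (\<tau> N j) (\<tau>hat2 N j \<omega>)\<bar>
                 \<le> int (walk_Q (\<bar>\<nu> N j - \<nu> N (j - 1)\<bar> + 2 * \<rho> N) (\<sigma> (j - 1)) (\<sigma> j) (root (J N) (1 - \<alpha>))))}
            - (\<Prod>j\<in>{1..J N}. walk_P (\<bar>\<nu> N j - \<nu> N (j - 1)\<bar> + 2 * \<rho> N) (\<sigma> (j - 1)) (\<sigma> j) (root (J N) (1 - \<alpha>))))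
           \<longlonglongrightarrow> 0"
proof -
  \<comment> \<open>Half the minimal jump leaves room for shifting the drift by
    \<open>2 * \<rho>\<close>.\<close>
  define D0 where "D0 = \<Delta>_min / 2"
  have D0: "D0 > 0" using M2(1) by (simp add: D0_def)
  define rate where "rate = walk_bounds.rate D0 \<sigma>_max"
  define U where "U = walk_bounds.unclear_const D0 \<sigma>_min \<sigma>_max"
  \<comment> \<open>For large \<open>N\<close>, \<open>R\<close> is the largest radius with
    \<open>2 * R + 1 \<le> w\<close>, and \<open>R'\<close> the smallest that is at least
    \<open>(K + 1) * w\<close>.\<close>
  define R where "R N = nat \<lfloor>(w N - 1) / 2\<rfloor>" for N
  define R' where "R' N = nat \<lceil>(real K + 1) * w N\<rceil>" for N
  \<comment> \<open>\<open>rate\<close> does not depend on the drift, so any admissible instance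
    shows that it is positive.\<close>
  have "walk_bounds D0 \<sigma>_min \<sigma>_max D0 (\<sigma> 0) (\<sigma> 0)"
    using D0 M4_Gaussian(1) M6(1)[of 0] by unfold_locales auto
  then have rate: "rate > 0" unfolding rate_def by (rule walk_bounds.rate_pos)
  let ?A = "\<lambda>N. {\<omega> \<in> space (M N). Jhat N \<omega> = J N \<and>
              (\<forall>i\<in>{1..J N}. \<bar>\<tau>hat1 N i \<omega> - real (\<tau> N i)\<bar> \<le> w N) \<and>
              (\<forall>i\<in>{0..J N}. \<bar>\<nu>hat1 N i \<omega> - \<nu> N i\<bar> \<le> \<rho> N)}"
  define b where "b N = (1 - measure (M N) (?A N)) + 2 * (real (J N) * (U * (2 * \<rho> N + exp (- rate * real (R N)))))" for N

  have chain: "\<tau> N 0 + j \<le> \<tau> N j \<and> \<tau> N j \<le> N" if "N \<ge> 3" "j \<le> J N + 1" for N j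
    using strict_chain_bounds[of "J N" "\<tau> N" j] change_points[OF that(1)] that(2) by auto
  have J_le: "real (J N) \<le> real N" if "N \<ge> 3" for N
    using chain[OF that, of "J N + 1"] change_points[OF that] by simp

  have ev_w: "\<forall>\<^sub>F N in sequentially. w N \<ge> 2"
    using window_width(1) by (simp add: filterlim_at_top)
  have ev_skip: "\<forall>\<^sub>F N in sequentially. skip K1 \<gamma> N \<ge> 2"
  proof -
    have "\<forall>\<^sub>F N in sequentially. real N / (K1 * real N powr \<gamma>) \<ge> 2"
      using filterlim_skip_ratio[OF sampling(1,3)] by (simp add: filterlim_at_top)
    then show ?thesis
      by eventually_elim (simp add: skip_def le_nat_floor)
  qed
  have ev_gap: "\<forall>\<^sub>F N in sequentially. \<forall>j\<le>J N. \<tau> N j + 4 * R' N + 1 \<le> \<tau> N (j + 1)"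
  proof -
    \<comment> \<open>After rounding, \<open>4 * R' + 1\<close> is at most
      \<open>4 * (K + 1) * w + 5\<close>, which is below \<open>8 * (K + 1) * w\<close> because
      \<open>(K + 1) * w \<ge> 2\<close>.\<close>
    have "1 / (8 * (real K + 1)) > 0" by simp
    from landau_o.smallD[OF window_width(2) this] eventually_ge_at_top[of 3] ev_w
    show ?thesis
    proof eventually_elim
      case (elim N)
      then have "8 * ((real K + 1) * w N) \<le> real (min_gap (\<tau> N) (J N))"
        by (simp add: field_simps)
      moreover have "1 * 2 \<le> (real K + 1) * w N"
        using elim by (intro mult_mono) auto
      moreover from this have "real (R' N) \<le> (real K + 1) * w N + 1"
        unfolding R'_def by (intro real_nat_ceiling_le) simp
      ultimately have "real (4 * R' N + 1) \<le> real (min_gap (\<tau> N) (J N))"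
        unfolding of_nat_add of_nat_mult of_nat_numeral of_nat_1 by linarith
      then have gap: "4 * R' N + 1 \<le> min_gap (\<tau> N) (J N)" by (simp only: of_nat_le_iff)
      show ?case
      proof (intro allI impI)
        fix j assume j: "j \<le> J N"
        then have "min_gap (\<tau> N) (J N) \<le> \<tau> N (j + 1) - \<tau> N j"
          unfolding min_gap_def by (intro Min_le) auto
        moreover have "\<tau> N j < \<tau> N (j + 1)" using change_points[of N] elim j by auto
        ultimately show "\<tau> N j + 4 * R' N + 1 \<le> \<tau> N (j + 1)" using gap by linarith
      qed
    qed
  qed
  \<comment> \<open>An event of positive probability contains a point, and at that point some
    modulus is at most \<open>\<rho> N\<close>.\<close>
  have ev_\<rho>: "\<forall>\<^sub>F N in sequentially. 0 \<le> \<rho> N"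
  proof -
    have "\<forall>\<^sub>F N in sequentially. measure (M N) (?A N) > 0"
      using order_tendstoD(1)[OF first_stage_consistency, of 0] by simp
    then show ?thesis
    proof eventually_elim
      case (elim N)
      then have "?A N \<noteq> {}" by (metis (lifting) less_irrefl measure_empty)
      then obtain \<omega> where "\<bar>\<nu>hat1 N 0 \<omega> - \<nu> N 0\<bar> \<le> \<rho> N" by fastforce
      then show ?case by linarith
    qed
  qed
  \<comment> \<open>The bound \<open>\<Delta>_min / 64\<close> makes \<open>2 * \<rho>\<close> at
    most \<open>D0 / 16\<close>.\<close>
  have ev_\<rho>': "\<forall>\<^sub>F N in sequentially. \<rho> N < \<Delta>_min / 64"
    using M2(1) by (intro order_tendstoD(2)[OF level_rate(1)]) simp

  have b: "b \<longlonglongrightarrow> 0"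
  proof -
    have tail: "(\<lambda>N. real (J N) * exp (- rate * real (R N))) \<longlonglongrightarrow> 0"
    proof (rule Lim_null_comparison[OF _ tendsto_mult_exp_neg_powr[OF rate window_width(3) sampling(3)]])
      show "\<forall>\<^sub>F N in sequentially. norm (real (J N) * exp (- rate * real (R N)))
        \<le> real N * exp (- rate * ((c * real N powr (1 - \<gamma>) - 3) / 2))"
        using eventually_ge_at_top[of 3] ev_w
      proof eventually_elim
        case (elim N)
        have "(w N - 3) / 2 \<le> real (R N)"
          using real_nat_floor_ge[of "(w N - 1) / 2"] unfolding R_def by (simp add: diff_divide_distrib)
        then have "(c * real N powr (1 - \<gamma>) - 3) / 2 \<le> real (R N)"
          using window_width(4)[OF elim(1)] by simp
        then have "exp (- rate * real (R N)) \<le> exp (- rate * ((c * real N powr (1 - \<gamma>) - 3) / 2))"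
          using rate by simp
        then show ?case
          using J_le[OF elim(1)] by (simp add: abs_mult mult_mono)
      qed
    qed
    have "(\<lambda>N. (1 - measure (M N) (?A N)) + 2 * (U * (2 * (real (J N) * \<rho> N) + real (J N) * exp (- rate * real (R N)))))
        \<longlonglongrightarrow> (1 - 1) + 2 * (U * (2 * 0 + 0))"
      by (intro tendsto_intros first_stage_consistency level_rate tail)
    then show ?thesis unfolding b_def by (simp add: algebra_simps)
  qed

  \<comment> \<open>The levels \<open>q\<close> are arbitrary, and shifts by
    \<open>- 2 * \<rho>\<close> and by \<open>2 * \<rho>\<close> are both admissible, so one
    statement covers both claims. The modulus of \<open>\<rho> N\<close> keeps the condition
    satisfiable at small \<open>N\<close>, where \<open>\<rho> N\<close> may be negative.\<close>
  have main: "(\<lambda>N. measure (M N) {\<omega> \<in> space (M N). Jhat N \<omega> = J N \<and>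
          (\<forall>j\<in>{1..J N}. \<bar>lambda2 K1 \<gamma> N (\<tau> N j) (\<tau>hat2 N j \<omega>)\<bar> \<le> int (q N j))}
        - (\<Prod>j\<in>{1..J N}. walk_cdf (\<Delta> N j) (\<sigma> (j - 1)) (\<sigma> j) (q N j))) \<longlonglongrightarrow> 0"
    if \<Delta>: "\<And>N j. \<bar>\<Delta> N j - \<bar>\<nu> N j - \<nu> N (j - 1)\<bar>\<bar> \<le> 2 * \<bar>\<rho> N\<bar>" for \<Delta> q
  proof (rule Lim_null_comparison[OF _ b])
    show "\<forall>\<^sub>F N in sequentially. norm (measure (M N) {\<omega> \<in> space (M N). Jhat N \<omega> = J N \<and>
          (\<forall>j\<in>{1..J N}. \<bar>lambda2 K1 \<gamma> N (\<tau> N j) (\<tau>hat2 N j \<omega>)\<bar> \<le> int (q N j))}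
        - (\<Prod>j\<in>{1..J N}. walk_cdf (\<Delta> N j) (\<sigma> (j - 1)) (\<sigma> j) (q N j))) \<le> b N"
      using eventually_ge_at_top[of 3] ev_w ev_skip ev_gap ev_\<rho> ev_\<rho>'
    proof eventually_elim
      case (elim N)
      note N = elim(1)
      have seg: "i \<in> {1..N}" if "j \<le> J N" "i \<in> {\<tau> N j<..\<tau> N (j + 1)}" for i j
      proof -
        have "j + 1 \<le> J N + 1" using that(1) by (rule add_right_mono)
        from chain[OF N this] have "\<tau> N (j + 1) \<le> N" by (rule conjunct2)
        then show ?thesis using that(2) unfolding greaterThanAtMost_iff atLeastAtMost_iff by linarith
      qed
      have Y_meas: "Y N i \<in> borel_measurable (M N)" if i: "i \<in> {1..N}" for i
      proof -
        have "\<forall>i\<in>{1..N}. \<epsilon> N i \<in> borel_measurable (M N)"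
          using M4_Gaussian(3)[OF N] unfolding prob_space.indep_vars_def2[OF prob_space[OF N]] by (rule conjunct1)
        then have "(\<lambda>\<omega>. \<theta> N i + \<epsilon> N i \<omega>) \<in> borel_measurable (M N)"
          using i by (intro borel_measurable_add borel_measurable_const) (rule bspec)
        then show ?thesis
          by (rule measurable_cong[THEN iffD2, rotated]) (rule observations[OF N i])
      qed
      have grid: "i \<in> {1..N}" if "i \<in> grid K1 \<gamma> N" for i using that by (simp add: grid_def)
      have sep: "\<Delta>_min \<le> \<bar>\<nu> N j - \<nu> N (j - 1)\<bar>" if "j \<in> {1..J N}" for j
        using M2(2)[OF N that] .
      have R: "2 * real (R N) + 1 \<le> w N"
        using of_nat_floor[of "(w N - 1) / 2"] elim(2) unfolding R_def by simp
      have R': "(real K + 1) * w N \<le> real (R' N)" unfolding R'_def by (rule real_nat_ceiling_ge)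
      have loc: "two_stage_sample (M N) (Y N) (\<epsilon> N) N (J N) (\<tau> N) (\<nu> N) \<sigma> K1 \<gamma> (Jhat N)
          (\<tau>hat1 N) (\<nu>hat1 N) (\<tau>hat2 N) (w N) (\<rho> N) K (R N) (R' N) (\<Delta> N) D0 \<sigma>_min \<sigma>_max"
      proof (intro two_stage_sample.intro two_stage_sample_axioms.intro)
        show "Y N i \<omega> = \<nu> N j + \<epsilon> N i \<omega>"
          if "j \<le> J N" "i \<in> {\<tau> N j<..\<tau> N (j + 1)}" "\<omega> \<in> space (M N)" for j i \<omega>
          using observations[OF N seg[OF that(1,2)] that(3)] levels[OF N] that by simp
        show "distributed (M N) lborel (\<epsilon> N i) (\<lambda>x. ennreal (normal_density 0 (\<sigma> j) x))"
          if "j \<le> J N" "i \<in> {\<tau> N j<..\<tau> N (j + 1)}" for j i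
          using M6(2)[OF N _ that(2)] that(1) by simp
        show "D0 \<le> \<Delta> N j" if "j \<in> {1..J N}" for j
          using sep[OF that] \<Delta>[of N j] elim(5,6) unfolding D0_def by linarith
        show "2 * \<rho> N < \<bar>\<nu> N j - \<nu> N (j - 1)\<bar>" if "j \<in> {1..J N}" for j
          using sep[OF that] elim(5,6) M2(1) by linarith
        show "\<bar>\<Delta> N j - \<bar>\<nu> N j - \<nu> N (j - 1)\<bar>\<bar> \<le> 2 * \<rho> N" for j
          using \<Delta>[of N j] elim(5) by simp
        show "Jhat N \<in> measurable (M N) (count_space UNIV)"
          by (rule statistic_of_measurable[OF first_stage(1)[OF N] Y_meas[OF grid]])
        show "\<tau>hat1 N i \<in> borel_measurable (M N)" for i
          by (rule statistic_of_measurable[OF first_stage(2)[OF N] Y_meas[OF grid]])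
        show "\<nu>hat1 N i \<in> borel_measurable (M N)" for i
          by (rule statistic_of_measurable[OF first_stage(3)[OF N] Y_meas[OF grid]])
        show "2 * \<rho> N \<le> D0 / 16" using elim(6) unfolding D0_def by simp
        show "J N \<ge> 1" "\<tau> N 0 = 1" "\<tau> N (J N + 1) = N" using change_points[OF N] by blast+
        show "\<tau> N j + 4 * R' N + 1 \<le> \<tau> N (j + 1)" if "j \<le> J N" for j using elim(4) that by blast
      qed (fact prob_space[OF N] Y_meas M4_Gaussian(3)[OF N] M6(1) M4_Gaussian(1) elim(3) second_stage(1)
            R R' elim(5) D0 second_stage(2)[OF N])+
      have "{\<omega> \<in> space (M N). two_stage_sample.consistent (J N) (\<tau> N) (\<nu> N) (Jhat N) (\<tau>hat1 N) (\<nu>hat1 N) (w N) (\<rho> N) \<omega>}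
          = ?A N"
        unfolding two_stage_sample.consistent_def[OF loc] ..
      then show ?case
        using two_stage_sample.coverage_error[OF loc, of "q N"]
        unfolding b_def U_def rate_def two_stage_sample.err_def[OF loc] real_norm_def by simp
    qed
  qed
  show ?thesis
    unfolding walk_P_def by (intro conjI main) auto
qed

end
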